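(* Let $\mathcal{A}$ be a semi-abelian category with enough projectives satisfying condition (UCE) and $\mathcal{B}$ a Birkhoff subcategory of $\mathcal{A}$, with reflector $\mathsf{b}$, that contains $\mathsf{Ab}(\mathcal{A})$. Let $u\colon U\to A$ be a $\mathsf{b}$-central extension. If $U$ is $\mathsf{b}$-perfect and $u$ is a weakly universal $\mathsf{b}$-central extension, then $U$ is $\mathsf{b}$-perfect and every $\mathsf{b}$-central extension of $U$ splits. Hence a $\mathsf{b}$-central extension $u\colon U\to A$ is universal if and only if its domain $U$ is $\mathsf{b}$-perfect and projective with respect to all $\mathsf{b}$-central extensions.
   Context: A category is semi-abelian when it is pointed (terminal object $=$ initial object $=0$), Barr exact, Bourn protomodular (the regular Short Five Lemma holds), and has binary coproducts. It has enough projectives when every object is a regular quotient of a (regular) projective object. A Birkhoff subcategory $\mathcal{B}$ of $\mathcal{A}$ is a full and reflective subcategory closed under subobjects and regular quotients; its reflector is $\mathsf{b}\colon\mathcal{A}\to\mathcal{B}$, with unit $\eta\colon 1_{\mathcal{A}}\Rightarrow\mathsf{b}$. An extension is a regular epimorphism. An extension $f\colon B\to A$ is $\mathsf{b}$-trivial if the naturality square $\mathsf{b}(f)\circ\eta_B=\eta_A\circ f$ is a pullback, and $\mathsf{b}$-central if its pullback along some extension $g\colon C\to A$ is $\mathsf{b}$-trivial. An object $P$ is $\mathsf{b}$-perfect when $\mathsf{b}(P)=0$. A (weakly) universal $\mathsf{b}$-central extension of $A$ is a (weakly) initial object of the full subcategory $\mathsf{Centr}_{\mathsf{b}}(A)$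 of $(\mathcal{A}\downarrow A)$ determined by the $\mathsf{b}$-central extensions of $A$. An object $U$ is projective with respect to all $\mathsf{b}$-central extensions when for every $\mathsf{b}$-central extension $f\colon X\to Y$ every morphism $U\to Y$ factors through $f$. An extension splits when it admits a section. $\mathsf{Ab}(\mathcal{A})$ is the Birkhoff subcategory of $\mathcal{A}$ of all objects admitting an internal abelian group structure, with reflector $\mathsf{ab}\colon\mathcal{A}\to\mathsf{Ab}(\mathcal{A})$; $\mathsf{ab}$-perfect and $\mathsf{ab}$-central are the notions above for this Birkhoff subcategory. A semi-abelian category $\mathcal{A}$ with enough projectives satisfies condition (UCE) when: if $B$ is an $\mathsf{ab}$-perfect object and $f\colon B\to A$ and $g\colon C\to B$ are $\mathsf{ab}$-central extensions, then the extension $f\circ g$ is $\mathsf{ab}$-central. *)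

theory Defs
  imports Main
begin

text \<open>
  Categories are records of a set of objects and a set of arrows; the remaining fields are
  meaningful only on these sets. Composition is written in the usual (applicative) order:
  \<open>g \<odot>\<^bsub>C\<^esub> f\<close> is \<open>g\<close> after \<open>f\<close>.
\<close>

record ('o, 'm) cat =
  Obj :: "'o set"
  Arr :: "'m set"
  Dom :: "'m \<Rightarrow> 'o"
  Cod :: "'m \<Rightarrow> 'o"
  Id :: "'o \<Rightarrow> 'm"
  Comp :: "'m \<Rightarrow> 'm \<Rightarrow> 'm"  (infixr "\<odot>\<index>" 70)

definition Hom :: "('o, 'm) cat \<Rightarrow> 'o \<Rightarrow> 'o \<Rightarrow> 'm set" where
  "Hom C X Y = {f \<in> Arr C. Dom C f = X \<and> Cod C f = Y}"

locale category =
  fixes C :: "('o, 'm) cat" (structure)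
  assumes dom_obj: "f \<in> Arr C \<Longrightarrow> Dom C f \<in> Obj C"
    and cod_obj: "f \<in> Arr C \<Longrightarrow> Cod C f \<in> Obj C"
    and id_hom: "X \<in> Obj C \<Longrightarrow> Id C X \<in> Hom C X X"
    and comp_hom: "f \<in> Hom C X Y \<Longrightarrow> g \<in> Hom C Y Z \<Longrightarrow> g \<odot> f \<in> Hom C X Z"
    and id_left: "f \<in> Hom C X Y \<Longrightarrow> Id C Y \<odot> f = f"
    and id_right: "f \<in> Hom C X Y \<Longrightarrow> f \<odot> Id C X = f"
    and comp_assoc: "f \<in> Hom C W X \<Longrightarrow> g \<in> Hom C X Y \<Longrightarrow> h \<in> Hom C Y Z \<Longrightarrow>
      (h \<odot> g) \<odot> f = h \<odot> (g \<odot> f)"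

definition full_subcat :: "('o, 'm) cat \<Rightarrow> 'o set \<Rightarrow> ('o, 'm) cat" where
  "full_subcat C S = C\<lparr>Obj := S, Arr := {f \<in> Arr C. Dom C f \<in> S \<and> Cod C f \<in> S}\<rparr>"

text \<open>
  The slice over \<open>A\<close>: a morphism from \<open>f\<close> to \<open>g\<close> is a triple \<open>(f, h, g)\<close> with \<open>g \<odot> h = f\<close>.
\<close>

definition slice :: "('o, 'm) cat \<Rightarrow> 'o \<Rightarrow> ('m, 'm \<times> 'm \<times> 'm) cat" where
  "slice C A =
    \<lparr>Obj = {f \<in> Arr C. Cod C f = A},
     Arr = {(f, h, g). f \<in> Arr C \<and> Cod C f = A \<and> g \<in> Arr C \<and> Cod C g = A \<and>
              h \<in> Hom C (Dom C f) (Dom C g) \<and> g \<odot>\<^bsub>C\<^esub> h = f},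
     Dom = (\<lambda>(f, h, g). f),
     Cod = (\<lambda>(f, h, g). g),
     Id = (\<lambda>f. (f, Id C (Dom C f), f)),
     Comp = (\<lambda>(g, k, l) (f, h, g'). (f, k \<odot>\<^bsub>C\<^esub> h, l))\<rparr>"

definition is_functor ::
  "('o, 'm) cat \<Rightarrow> ('p, 'n) cat \<Rightarrow> ('o \<Rightarrow> 'p) \<Rightarrow> ('m \<Rightarrow> 'n) \<Rightarrow> bool" where
  "is_functor C D Fo Fa \<longleftrightarrow>
    (\<forall>X\<in>Obj C. Fo X \<in> Obj D) \<and>
    (\<forall>f\<in>Arr C. Fa f \<in> Hom D (Fo (Dom C f)) (Fo (Cod C f))) \<and>
    (\<forall>X\<in>Obj C. Fa (Id C X) = Id D (Fo X)) \<and>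
    (\<forall>f\<in>Arr C. \<forall>g\<in>Arr C. Dom C g = Cod C f \<longrightarrow> Fa (g \<odot>\<^bsub>C\<^esub> f) = Fa g \<odot>\<^bsub>D\<^esub> Fa f)"


section \<open>Limits and colimits\<close>

definition is_mono :: "('o, 'm) cat \<Rightarrow> 'm \<Rightarrow> bool" where
  "is_mono C m \<longleftrightarrow> m \<in> Arr C \<and>
    (\<forall>Z. \<forall>g \<in> Hom C Z (Dom C m). \<forall>h \<in> Hom C Z (Dom C m). m \<odot>\<^bsub>C\<^esub> g = m \<odot>\<^bsub>C\<^esub> h \<longrightarrow> g = h)"

definition is_iso :: "('o, 'm) cat \<Rightarrow> 'm \<Rightarrow> bool" where
  "is_iso C f \<longleftrightarrow> f \<in> Arr C \<and>
    (\<exists>g \<in> Hom C (Cod C f) (Dom C f).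
      g \<odot>\<^bsub>C\<^esub> f = Id C (Dom C f) \<and> f \<odot>\<^bsub>C\<^esub> g = Id C (Cod C f))"

definition splits :: "('o, 'm) cat \<Rightarrow> 'm \<Rightarrow> bool" where
  "splits C f \<longleftrightarrow> f \<in> Arr C \<and> (\<exists>s \<in> Hom C (Cod C f) (Dom C f). f \<odot>\<^bsub>C\<^esub> s = Id C (Cod C f))"

definition initial_object :: "('o, 'm) cat \<Rightarrow> 'o \<Rightarrow> bool" where
  "initial_object C I \<longleftrightarrow> I \<in> Obj C \<and> (\<forall>X\<in>Obj C. \<exists>!f. f \<in> Hom C I X)"

definition weakly_initial_object :: "('o, 'm) cat \<Rightarrow> 'o \<Rightarrow> bool" where
  "weakly_initial_object C I \<longleftrightarrow> I \<in> Obj C \<and> (\<forall>X\<in>Obj C. \<exists>f. f \<in> Hom C I X)"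

definition terminal_object :: "('o, 'm) cat \<Rightarrow> 'o \<Rightarrow> bool" where
  "terminal_object C T \<longleftrightarrow> T \<in> Obj C \<and> (\<forall>X\<in>Obj C. \<exists>!f. f \<in> Hom C X T)"

definition zero_object :: "('o, 'm) cat \<Rightarrow> 'o \<Rightarrow> bool" where
  "zero_object C Z \<longleftrightarrow> initial_object C Z \<and> terminal_object C Z"

definition is_product :: "('o, 'm) cat \<Rightarrow> 'm \<Rightarrow> 'm \<Rightarrow> 'o \<Rightarrow> 'o \<Rightarrow> bool" where
  "is_product C p1 p2 X Y \<longleftrightarrow>
    p1 \<in> Arr C \<and> p2 \<in> Arr C \<and> Dom C p1 = Dom C p2 \<and> Cod C p1 = X \<and> Cod C p2 = Y \<and>
    (\<forall>Z. \<forall>f \<in> Hom C Z X. \<forall>g \<in> Hom C Z Y.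
      \<exists>!h. h \<in> Hom C Z (Dom C p1) \<and> p1 \<odot>\<^bsub>C\<^esub> h = f \<and> p2 \<odot>\<^bsub>C\<^esub> h = g)"

text \<open>The morphism \<open>\<langle>f, g\<rangle>\<close> into the product with projections \<open>p1\<close>, \<open>p2\<close>.\<close>

definition tuple :: "('o, 'm) cat \<Rightarrow> 'm \<Rightarrow> 'm \<Rightarrow> 'm \<Rightarrow> 'm \<Rightarrow> 'm" where
  "tuple C p1 p2 f g =
    (THE h. h \<in> Hom C (Dom C f) (Dom C p1) \<and> p1 \<odot>\<^bsub>C\<^esub> h = f \<and> p2 \<odot>\<^bsub>C\<^esub> h = g)"

definition is_coproduct :: "('o, 'm) cat \<Rightarrow> 'm \<Rightarrow> 'm \<Rightarrow> 'o \<Rightarrow> 'o \<Rightarrow> bool" where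
  "is_coproduct C i1 i2 X Y \<longleftrightarrow>
    i1 \<in> Arr C \<and> i2 \<in> Arr C \<and> Cod C i1 = Cod C i2 \<and> Dom C i1 = X \<and> Dom C i2 = Y \<and>
    (\<forall>Z. \<forall>f \<in> Hom C X Z. \<forall>g \<in> Hom C Y Z.
      \<exists>!h. h \<in> Hom C (Cod C i1) Z \<and> h \<odot>\<^bsub>C\<^esub> i1 = f \<and> h \<odot>\<^bsub>C\<^esub> i2 = g)"

text \<open>
  \<open>is_pullback C p q f g\<close>: the square \<open>f \<odot> p = g \<odot> q\<close> is a pullback, so that \<open>p\<close> is the
  pullback of \<open>g\<close> along \<open>f\<close> and \<open>q\<close> is the pullback of \<open>f\<close> along \<open>g\<close>.
\<close>

definition is_pullback :: "('o, 'm) cat \<Rightarrow> 'm \<Rightarrow> 'm \<Rightarrow> 'm \<Rightarrow> 'm \<Rightarrow> bool" where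
  "is_pullback C p q f g \<longleftrightarrow>
    f \<in> Arr C \<and> g \<in> Arr C \<and> Cod C f = Cod C g \<and>
    p \<in> Arr C \<and> q \<in> Arr C \<and> Dom C p = Dom C q \<and> Cod C p = Dom C f \<and> Cod C q = Dom C g \<and>
    f \<odot>\<^bsub>C\<^esub> p = g \<odot>\<^bsub>C\<^esub> q \<and>
    (\<forall>Z. \<forall>x \<in> Hom C Z (Dom C f). \<forall>y \<in> Hom C Z (Dom C g). f \<odot>\<^bsub>C\<^esub> x = g \<odot>\<^bsub>C\<^esub> y \<longrightarrow>
      (\<exists>!h. h \<in> Hom C Z (Dom C p) \<and> p \<odot>\<^bsub>C\<^esub> h = x \<and> q \<odot>\<^bsub>C\<^esub> h = y))"

definition is_coequalizer :: "('o, 'm) cat \<Rightarrow> 'm \<Rightarrow> 'm \<Rightarrow> 'm \<Rightarrow> bool" where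
  "is_coequalizer C q f g \<longleftrightarrow>
    f \<in> Arr C \<and> g \<in> Arr C \<and> Dom C f = Dom C g \<and> Cod C f = Cod C g \<and>
    q \<in> Arr C \<and> Dom C q = Cod C f \<and> q \<odot>\<^bsub>C\<^esub> f = q \<odot>\<^bsub>C\<^esub> g \<and>
    (\<forall>Z. \<forall>x \<in> Hom C (Cod C f) Z. x \<odot>\<^bsub>C\<^esub> f = x \<odot>\<^bsub>C\<^esub> g \<longrightarrow>
      (\<exists>!h. h \<in> Hom C (Cod C q) Z \<and> h \<odot>\<^bsub>C\<^esub> q = x))"

definition regular_epi :: "('o, 'm) cat \<Rightarrow> 'm \<Rightarrow> bool" where
  "regular_epi C q \<longleftrightarrow> (\<exists>f g. is_coequalizer C q f g)"

abbreviation kernel_pair :: "('o, 'm) cat \<Rightarrow> 'm \<Rightarrow> 'm \<Rightarrow> 'm \<Rightarrow> bool" where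
  "kernel_pair C p q f \<equiv> is_pullback C p q f f"

definition zero_arrow :: "('o, 'm) cat \<Rightarrow> 'm \<Rightarrow> bool" where
  "zero_arrow C f \<longleftrightarrow> f \<in> Arr C \<and>
    (\<exists>Z g h. zero_object C Z \<and> g \<in> Hom C (Dom C f) Z \<and> h \<in> Hom C Z (Cod C f) \<and> f = h \<odot>\<^bsub>C\<^esub> g)"

definition is_kernel :: "('o, 'm) cat \<Rightarrow> 'm \<Rightarrow> 'm \<Rightarrow> bool" where
  "is_kernel C k f \<longleftrightarrow>
    f \<in> Arr C \<and> k \<in> Arr C \<and> Cod C k = Dom C f \<and> zero_arrow C (f \<odot>\<^bsub>C\<^esub> k) \<and>
    (\<forall>Z. \<forall>x \<in> Hom C Z (Dom C f). zero_arrow C (f \<odot>\<^bsub>C\<^esub> x) \<longrightarrow>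
      (\<exists>!h. h \<in> Hom C Z (Dom C k) \<and> k \<odot>\<^bsub>C\<^esub> h = x))"


section \<open>Semi-abelian categories\<close>

definition finitely_complete :: "('o, 'm) cat \<Rightarrow> bool" where
  "finitely_complete C \<longleftrightarrow>
    (\<exists>T. terminal_object C T) \<and>
    (\<forall>f\<in>Arr C. \<forall>g\<in>Arr C. Cod C f = Cod C g \<longrightarrow> (\<exists>p q. is_pullback C p q f g))"

definition regular_category :: "('o, 'm) cat \<Rightarrow> bool" where
  "regular_category C \<longleftrightarrow>
    category C \<and> finitely_complete C \<and>
    (\<forall>p q f. kernel_pair C p q f \<longrightarrow> (\<exists>e. is_coequalizer C e p q)) \<and>
    (\<forall>p q f g. is_pullback C p q f g \<and> regular_epi C g \<longrightarrow> regular_epi C p)"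

definition internal_equivalence_relation :: "('o, 'm) cat \<Rightarrow> 'm \<Rightarrow> 'm \<Rightarrow> 'o \<Rightarrow> bool" where
  "internal_equivalence_relation C r1 r2 X \<longleftrightarrow>
    r1 \<in> Arr C \<and> r2 \<in> Arr C \<and> Dom C r1 = Dom C r2 \<and> Cod C r1 = X \<and> Cod C r2 = X \<and>
    (\<forall>Z. \<forall>g \<in> Hom C Z (Dom C r1). \<forall>h \<in> Hom C Z (Dom C r1).
      r1 \<odot>\<^bsub>C\<^esub> g = r1 \<odot>\<^bsub>C\<^esub> h \<and> r2 \<odot>\<^bsub>C\<^esub> g = r2 \<odot>\<^bsub>C\<^esub> h \<longrightarrow> g = h) \<and>
    (\<exists>d \<in> Hom C X (Dom C r1). r1 \<odot>\<^bsub>C\<^esub> d = Id C X \<and> r2 \<odot>\<^bsub>C\<^esub> d = Id C X) \<and>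
    (\<exists>s \<in> Hom C (Dom C r1) (Dom C r1). r1 \<odot>\<^bsub>C\<^esub> s = r2 \<and> r2 \<odot>\<^bsub>C\<^esub> s = r1) \<and>
    (\<exists>p q. is_pullback C p q r2 r1 \<and>
      (\<exists>t \<in> Hom C (Dom C p) (Dom C r1).
        r1 \<odot>\<^bsub>C\<^esub> t = r1 \<odot>\<^bsub>C\<^esub> p \<and> r2 \<odot>\<^bsub>C\<^esub> t = r2 \<odot>\<^bsub>C\<^esub> q))"

definition barr_exact :: "('o, 'm) cat \<Rightarrow> bool" where
  "barr_exact C \<longleftrightarrow>
    regular_category C \<and>
    (\<forall>r1 r2 X. internal_equivalence_relation C r1 r2 X \<longrightarrow> (\<exists>f. kernel_pair C r1 r2 f))"

definition pointed :: "('o, 'm) cat \<Rightarrow> bool" where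
  "pointed C \<longleftrightarrow> (\<exists>Z. zero_object C Z)"

text \<open>
  The regular Short Five Lemma: \<open>(a, v, w)\<close> is a morphism from \<open>k, p\<close> to \<open>k', p'\<close>.
\<close>

definition protomodular :: "('o, 'm) cat \<Rightarrow> bool" where
  "protomodular C \<longleftrightarrow>
    (\<forall>k p k' p' a v w.
      regular_epi C p \<and> is_kernel C k p \<and> regular_epi C p' \<and> is_kernel C k' p' \<and>
      a \<in> Hom C (Dom C k) (Dom C k') \<and> v \<in> Hom C (Dom C p) (Dom C p') \<and>
      w \<in> Hom C (Cod C p) (Cod C p') \<and>
      k' \<odot>\<^bsub>C\<^esub> a = v \<odot>\<^bsub>C\<^esub> k \<and> p' \<odot>\<^bsub>C\<^esub> v = w \<odot>\<^bsub>C\<^esub> p \<and>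
      is_iso C a \<and> is_iso C w \<longrightarrow> is_iso C v)"

definition semi_abelian :: "('o, 'm) cat \<Rightarrow> bool" where
  "semi_abelian C \<longleftrightarrow>
    category C \<and> pointed C \<and> barr_exact C \<and> protomodular C \<and>
    (\<forall>X\<in>Obj C. \<forall>Y\<in>Obj C. \<exists>i1 i2. is_coproduct C i1 i2 X Y)"

definition projective_object :: "('o, 'm) cat \<Rightarrow> 'o \<Rightarrow> bool" where
  "projective_object C P \<longleftrightarrow> P \<in> Obj C \<and>
    (\<forall>e. regular_epi C e \<longrightarrow>
      (\<forall>y \<in> Hom C P (Cod C e). \<exists>x \<in> Hom C P (Dom C e). e \<odot>\<^bsub>C\<^esub> x = y))"

definition enough_projectives :: "('o, 'm) cat \<Rightarrow> bool" where
  "enough_projectives C \<longleftrightarrow>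
    (\<forall>X\<in>Obj C. \<exists>P e. projective_object C P \<and> regular_epi C e \<and> e \<in> Hom C P X)"


section \<open>Birkhoff subcategories\<close>

text \<open>
  Full subcategories are given by their sets of objects. A reflector is recorded with its
  object part, its arrow part and the unit; it is viewed as an endofunctor through the inclusion.
\<close>

record ('o, 'm) reflector =
  refl_obj :: "'o \<Rightarrow> 'o"
  refl_arr :: "'m \<Rightarrow> 'm"
  refl_unit :: "'o \<Rightarrow> 'm"

definition is_reflector :: "('o, 'm) cat \<Rightarrow> 'o set \<Rightarrow> ('o, 'm) reflector \<Rightarrow> bool" where
  "is_reflector C B b \<longleftrightarrow>
    is_functor C (full_subcat C B) (refl_obj b) (refl_arr b) \<and>
    (\<forall>X\<in>Obj C. refl_unit b X \<in> Hom C X (refl_obj b X)) \<and>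
    (\<forall>f\<in>Arr C. refl_arr b f \<odot>\<^bsub>C\<^esub> refl_unit b (Dom C f) = refl_unit b (Cod C f) \<odot>\<^bsub>C\<^esub> f) \<and>
    (\<forall>X\<in>Obj C. \<forall>Y\<in>B. \<forall>f \<in> Hom C X Y.
      \<exists>!g. g \<in> Hom C (refl_obj b X) Y \<and> g \<odot>\<^bsub>C\<^esub> refl_unit b X = f)"

definition birkhoff_subcategory :: "('o, 'm) cat \<Rightarrow> 'o set \<Rightarrow> bool" where
  "birkhoff_subcategory C B \<longleftrightarrow>
    B \<subseteq> Obj C \<and> (\<exists>b. is_reflector C B b) \<and>
    (\<forall>m. is_mono C m \<and> Cod C m \<in> B \<longrightarrow> Dom C m \<in> B) \<and>
    (\<forall>q. regular_epi C q \<and> Dom C q \<in> B \<longrightarrow> Cod C q \<in> B)"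

text \<open>
  An internal abelian group \<open>(X, m, e, i)\<close>. Here \<open>p1, p2\<close> are the projections of \<open>X \<times> X\<close>,
  \<open>a, c\<close> those of \<open>(X \<times> X) \<times> X\<close>, and \<open>T\<close> is the terminal object. The associativity
  law is \<open>m \<circ> (m \<times> 1) = m \<circ> (1 \<times> m)\<close> up to the canonical isomorphism
  \<open>(X \<times> X) \<times> X \<cong> X \<times> (X \<times> X)\<close>.
\<close>

definition internal_abelian_group ::
  "('o, 'm) cat \<Rightarrow> 'o \<Rightarrow> 'm \<Rightarrow> 'm \<Rightarrow> 'm \<Rightarrow> 'm \<Rightarrow> 'o \<Rightarrow> 'm \<Rightarrow> 'm \<Rightarrow> 'm \<Rightarrow> bool" where
  "internal_abelian_group C X p1 p2 a c T m e i \<longleftrightarrow>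
    X \<in> Obj C \<and> is_product C p1 p2 X X \<and> is_product C a c (Dom C p1) X \<and> terminal_object C T \<and>
    m \<in> Hom C (Dom C p1) X \<and> e \<in> Hom C T X \<and> i \<in> Hom C X X \<and>
    (\<forall>t \<in> Hom C X T.
      m \<odot>\<^bsub>C\<^esub> tuple C p1 p2 (Id C X) (e \<odot>\<^bsub>C\<^esub> t) = Id C X \<and>
      m \<odot>\<^bsub>C\<^esub> tuple C p1 p2 (e \<odot>\<^bsub>C\<^esub> t) (Id C X) = Id C X \<and>
      m \<odot>\<^bsub>C\<^esub> tuple C p1 p2 (Id C X) i = e \<odot>\<^bsub>C\<^esub> t \<and>
      m \<odot>\<^bsub>C\<^esub> tuple C p1 p2 i (Id C X) = e \<odot>\<^bsub>C\<^esub> t) \<and>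
    m \<odot>\<^bsub>C\<^esub> tuple C p1 p2 (m \<odot>\<^bsub>C\<^esub> a) c =
      m \<odot>\<^bsub>C\<^esub> tuple C p1 p2 (p1 \<odot>\<^bsub>C\<^esub> a) (m \<odot>\<^bsub>C\<^esub> tuple C p1 p2 (p2 \<odot>\<^bsub>C\<^esub> a) c) \<and>
    m \<odot>\<^bsub>C\<^esub> tuple C p1 p2 p2 p1 = m"

definition abelian_objects :: "('o, 'm) cat \<Rightarrow> 'o set" where
  "abelian_objects C =
    {X. \<exists>p1 p2 a c T m e i. internal_abelian_group C X p1 p2 a c T m e i}"


section \<open>Central extensions\<close>

abbreviation extension :: "('o, 'm) cat \<Rightarrow> 'm \<Rightarrow> bool" where
  "extension C f \<equiv> regular_epi C f"

definition trivial_extension :: "('o, 'm) cat \<Rightarrow> ('o, 'm) reflector \<Rightarrow> 'm \<Rightarrow> bool" where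
  "trivial_extension C b f \<longleftrightarrow> extension C f \<and>
    is_pullback C (refl_unit b (Dom C f)) f (refl_arr b f) (refl_unit b (Cod C f))"

definition central_extension :: "('o, 'm) cat \<Rightarrow> ('o, 'm) reflector \<Rightarrow> 'm \<Rightarrow> bool" where
  "central_extension C b f \<longleftrightarrow> extension C f \<and>
    (\<exists>g p q. extension C g \<and> is_pullback C p q g f \<and> trivial_extension C b p)"

definition perfect :: "('o, 'm) cat \<Rightarrow> ('o, 'm) reflector \<Rightarrow> 'o \<Rightarrow> bool" where
  "perfect C b P \<longleftrightarrow> P \<in> Obj C \<and> zero_object C (refl_obj b P)"

definition Centr :: "('o, 'm) cat \<Rightarrow> ('o, 'm) reflector \<Rightarrow> 'o \<Rightarrow> ('m, 'm \<times> 'm \<times> 'm) cat" where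
  "Centr C b A = full_subcat (slice C A) {f \<in> Obj (slice C A). central_extension C b f}"

definition universal_central_extension ::
  "('o, 'm) cat \<Rightarrow> ('o, 'm) reflector \<Rightarrow> 'o \<Rightarrow> 'm \<Rightarrow> bool" where
  "universal_central_extension C b A u \<longleftrightarrow> initial_object (Centr C b A) u"

definition weakly_universal_central_extension ::
  "('o, 'm) cat \<Rightarrow> ('o, 'm) reflector \<Rightarrow> 'o \<Rightarrow> 'm \<Rightarrow> bool" where
  "weakly_universal_central_extension C b A u \<longleftrightarrow> weakly_initial_object (Centr C b A) u"

definition projective_wrt_central :: "('o, 'm) cat \<Rightarrow> ('o, 'm) reflector \<Rightarrow> 'o \<Rightarrow> bool" where
  "projective_wrt_central C b U \<longleftrightarrow> U \<in> Obj C \<and>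
    (\<forall>f. central_extension C b f \<longrightarrow>
      (\<forall>y \<in> Hom C U (Cod C f). \<exists>x \<in> Hom C U (Dom C f). f \<odot>\<^bsub>C\<^esub> x = y))"

text \<open>Here \<open>ab\<close> is the reflector onto \<open>abelian_objects C\<close>.\<close>

definition UCE :: "('o, 'm) cat \<Rightarrow> ('o, 'm) reflector \<Rightarrow> bool" where
  "UCE C ab \<longleftrightarrow>
    (\<forall>f g. central_extension C ab f \<and> central_extension C ab g \<and> Cod C g = Dom C f \<and>
      perfect C ab (Dom C f) \<longrightarrow> central_extension C ab (f \<odot>\<^bsub>C\<^esub> g))"

end

theory Submission
  imports Defs
begin

text \<open>
  The unit \<open>\<eta>\<close> of a reflector has a kernel \<open>[X] \<subseteq> X\<close>, functorial in \<open>X\<close>; call a generalized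
  element \<open>x\<close> of \<open>X\<close> null if \<open>\<eta> \<odot> x = 0\<close>, that is, if it lies in \<open>[X]\<close>. An object is perfect if and
  only if all of its elements are null. The proof rests on a description of centrality in these
  terms (\<open>central_iff_null_central\<close>): an extension \<open>f\<close> is central if and only if any two maps that
  become equal after composition with \<open>f\<close> agree on null elements. Stability of central extensions
  under pullback and under restriction to a subobject that still covers the base is then immediate,
  and so is the fact that two maps from a perfect object to a central extension agree as soon as
  their composites with the extension do.

  The description needs null elements to lift along regular epimorphisms (\<open>null_lift\<close>). This is
  where the axioms come together: protomodularity makes the direct image of the kernel pair of \<open>\<eta>\<close> an equivalence
  relation, exactness makes it the kernel pair of a quotient, and closure of the Birkhoff subcategory
  under quotients puts that quotient into the subcategory.

  Let \<open>U\<close> be perfect, \<open>u\<close> weakly universal and \<open>f\<close> a central extension of \<open>U\<close> with domain \<open>V\<close>. The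
  object \<open>[V]\<close> is perfect, and \<open>f\<close> restricts to a central extension of \<open>U\<close> by it (\<open>perfect_core\<close>).
  This reduces the question to extensions with perfect domain, and for these centrality relative to
  \<open>B\<close> and relative to the abelian objects amount to the same: if \<open>W\<close> is the perfect domain of a
  central extension with kernel pair \<open>R\<close>, then \<open>R = W \<times> b R\<close>, and \<open>b R\<close> carries a subtraction, hence
  is abelian (\<open>kernel_pair_reflection_abelian\<close>, \<open>central_perfect_domain\<close>). Condition (UCE) therefore
  applies to \<open>u\<close> and to the restriction of \<open>f\<close>; their composite is central, weak universality gives a
  map from \<open>u\<close> to it over \<open>A\<close>, and since \<open>U\<close> is perfect this map is a section of \<open>f\<close>.

  For the equivalence, a universal \<open>u\<close> has a perfect domain because \<open>(u, \<eta>)\<close> and \<open>(u, 0)\<close> are maps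
  over \<open>A\<close> into the central extension \<open>A \<times> b U \<rightarrow> A\<close>; splitting of all central extensions of \<open>U\<close> is
  the same as projectivity because central extensions are stable under pullback; and projectivity
  gives the maps out of \<open>u\<close>, whose uniqueness is the perfectness of \<open>U\<close>.
\<close>

section \<open>Categories\<close>

lemma Ex1_at_most_one: "\<exists>!x. P x \<Longrightarrow> P a \<Longrightarrow> P b \<Longrightarrow> a = b"
  by blast

context category
begin

lemma HomD:
  assumes "f \<in> Hom C X Y"
  shows "f \<in> Arr C" "Dom C f = X" "Cod C f = Y" "X \<in> Obj C" "Y \<in> Obj C"
  using assms dom_obj cod_obj by (auto simp: Hom_def)

lemma Hom_iff [simp]: "f \<in> Hom C X Y \<longleftrightarrow> f \<in> Arr C \<and> Dom C f = X \<and> Cod C f = Y"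
  by (simp add: Hom_def)

lemma comp_simps [simp]:
  assumes "f \<in> Arr C" "g \<in> Arr C" "Cod C f = Dom C g"
  shows "g \<odot> f \<in> Arr C" "Dom C (g \<odot> f) = Dom C f" "Cod C (g \<odot> f) = Cod C g"
  using comp_hom[of f "Dom C f" "Cod C f" g "Cod C g"] assms by auto

lemma assoc [simp]:
  assumes "f \<in> Arr C" "g \<in> Arr C" "h \<in> Arr C" "Cod C f = Dom C g" "Cod C g = Dom C h"
  shows "(h \<odot> g) \<odot> f = h \<odot> (g \<odot> f)"
  using comp_assoc[of f "Dom C f" "Cod C f" g "Cod C g" h "Cod C h"] assms by auto

lemma id_simps [simp]:
  assumes "X \<in> Obj C"
  shows "Id C X \<in> Arr C" "Dom C (Id C X) = X" "Cod C (Id C X) = X"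
  using id_hom[OF assms] by auto

lemma id_comp [simp]: "f \<in> Arr C \<Longrightarrow> Cod C f = X \<Longrightarrow> Id C X \<odot> f = f"
  using id_left[of f "Dom C f" X] by auto

lemma comp_id [simp]: "f \<in> Arr C \<Longrightarrow> Dom C f = X \<Longrightarrow> f \<odot> Id C X = f"
  using id_right[of f X "Cod C f"] by auto

lemma dom_cod_obj [simp]: "f \<in> Arr C \<Longrightarrow> Dom C f \<in> Obj C" "f \<in> Arr C \<Longrightarrow> Cod C f \<in> Obj C"
  by (simp_all add: dom_obj cod_obj)

lemma precomp_eq:
  assumes "a \<odot> b = c" "b \<in> Arr C" "a \<in> Arr C" "Cod C b = Dom C a" "z \<in> Arr C" "Cod C z = Dom C b"
  shows "a \<odot> (b \<odot> z) = c \<odot> z"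
  using assms assoc[of z b a] by simp

lemma mono_cancel:
  assumes "is_mono C m" "m \<odot> g = m \<odot> h" "g \<in> Hom C Z (Dom C m)" "h \<in> Hom C Z (Dom C m)"
  shows "g = h"
  using assms unfolding is_mono_def by blast

lemma pullback_lift:
  assumes "is_pullback C p q f g" "x \<in> Hom C Z (Dom C f)" "y \<in> Hom C Z (Dom C g)" "f \<odot> x = g \<odot> y"
  obtains h where "h \<in> Hom C Z (Dom C p)" "p \<odot> h = x" "q \<odot> h = y"
proof -
  have "\<exists>!h. h \<in> Hom C Z (Dom C p) \<and> p \<odot> h = x \<and> q \<odot> h = y"
    using assms unfolding is_pullback_def by blast
  then show ?thesis using that by blast
qed

lemma pullback_eq:
  assumes "is_pullback C p q f g" "h \<in> Hom C Z (Dom C p)" "h' \<in> Hom C Z (Dom C p)"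
    "p \<odot> h = p \<odot> h'" "q \<odot> h = q \<odot> h'"
  shows "h = h'"
proof -
  have *: "f \<in> Arr C" "g \<in> Arr C" "p \<in> Arr C" "q \<in> Arr C" "Dom C q = Dom C p"
    "Cod C p = Dom C f" "Cod C q = Dom C g" "f \<odot> p = g \<odot> q" "Cod C f = Cod C g"
    using assms(1) unfolding is_pullback_def by auto
  have "f \<odot> (p \<odot> h) = g \<odot> (q \<odot> h)"
    using * assms(2) precomp_eq[OF *(8), of h] by simp
  moreover have "p \<odot> h \<in> Hom C Z (Dom C f)" "q \<odot> h \<in> Hom C Z (Dom C g)"
    using * assms(2) by auto
  ultimately have "\<exists>!k. k \<in> Hom C Z (Dom C p) \<and> p \<odot> k = p \<odot> h \<and> q \<odot> k = q \<odot> h"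
    using assms(1) unfolding is_pullback_def by blast
  then show ?thesis by (rule Ex1_at_most_one) (use assms in simp_all)
qed

lemma pullbackD:
  assumes "is_pullback C p q f g"
  shows "p \<in> Arr C" "q \<in> Arr C" "f \<in> Arr C" "g \<in> Arr C" "Dom C q = Dom C p"
    "Cod C p = Dom C f" "Cod C q = Dom C g"
  using assms unfolding is_pullback_def by auto

lemma pullback_square:
  assumes "is_pullback C p q f g"
  shows "f \<odot> p = g \<odot> q" "Cod C f = Cod C g"
  using assms unfolding is_pullback_def by auto

lemma pullback_mono:
  assumes P: "is_pullback C p q f m" and m: "is_mono C m"
  shows "is_mono C p"
  unfolding is_mono_def
proof (intro conjI allI ballI impI)
  note [simp] = pullbackD[OF P] pullback_square(2)[OF P]
  show "p \<in> Arr C" by simp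
  fix Z g h assume gh: "g \<in> Hom C Z (Dom C p)" "h \<in> Hom C Z (Dom C p)" "p \<odot> g = p \<odot> h"
  note [simp] = HomD[OF gh(1)] HomD[OF gh(2)]
  have "m \<odot> (q \<odot> g) = m \<odot> (q \<odot> h)"
    using gh(3) precomp_eq[OF pullback_square(1)[OF P], of g] precomp_eq[OF pullback_square(1)[OF P], of h] by simp
  from mono_cancel[OF m this, of Z] have "q \<odot> g = q \<odot> h"
    by simp
  with gh show "g = h" using pullback_eq[OF P] by blast
qed

lemma is_iso_inverse:
  assumes "is_iso C f"
  obtains g where "g \<in> Hom C (Cod C f) (Dom C f)" "g \<odot> f = Id C (Dom C f)" "f \<odot> g = Id C (Cod C f)"
  using assms unfolding is_iso_def by blast

lemma mono_split_iso:
  assumes m: "is_mono C m" and h: "h \<in> Hom C (Cod C m) (Dom C m)" "m \<odot> h = Id C (Cod C m)"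
  shows "is_iso C m"
proof -
  have [simp]: "m \<in> Arr C" using m by (simp add: is_mono_def)
  note [simp] = HomD[OF h(1)]
  have "m \<odot> (h \<odot> m) = m \<odot> Id C (Dom C m)"
    using precomp_eq[OF h(2), of m] by simp
  from mono_cancel[OF m this, of "Dom C m"] have "h \<odot> m = Id C (Dom C m)"
    by simp
  with h show ?thesis unfolding is_iso_def by auto
qed

lemma tuple_props:
  assumes P: "is_product C p1 p2 X Y" and f: "f \<in> Hom C Z X" and g: "g \<in> Hom C Z Y"
  shows "tuple C p1 p2 f g \<in> Hom C Z (Dom C p1)"
    "p1 \<odot> tuple C p1 p2 f g = f" "p2 \<odot> tuple C p1 p2 f g = g"
proof -
  have *: "\<exists>!h. h \<in> Hom C (Dom C f) (Dom C p1) \<and> p1 \<odot> h = f \<and> p2 \<odot> h = g"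
    using assms unfolding is_product_def HomD(2)[OF f] by blast
  from theI'[OF *] f show "tuple C p1 p2 f g \<in> Hom C Z (Dom C p1)"
    "p1 \<odot> tuple C p1 p2 f g = f" "p2 \<odot> tuple C p1 p2 f g = g"
    unfolding tuple_def by auto
qed

lemma productD:
  assumes "is_product C p1 p2 X Y"
  shows "p1 \<in> Arr C" "p2 \<in> Arr C" "Dom C p2 = Dom C p1" "Cod C p1 = X" "Cod C p2 = Y"
    "X \<in> Obj C" "Y \<in> Obj C"
  using assms unfolding is_product_def by auto

lemma product_eq:
  assumes "is_product C p1 p2 X Y" "h \<in> Hom C Z (Dom C p1)" "h' \<in> Hom C Z (Dom C p1)"
    "p1 \<odot> h = p1 \<odot> h'" "p2 \<odot> h = p2 \<odot> h'"
  shows "h = h'"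
proof -
  note [simp] = productD[OF assms(1)]
  have "p1 \<odot> h \<in> Hom C Z X" "p2 \<odot> h \<in> Hom C Z Y" using assms(2) by auto
  then have "\<exists>!k. k \<in> Hom C Z (Dom C p1) \<and> p1 \<odot> k = p1 \<odot> h \<and> p2 \<odot> k = p2 \<odot> h"
    using assms(1) unfolding is_product_def by blast
  then show ?thesis by (rule Ex1_at_most_one) (use assms in simp_all)
qed

lemma tuple_comp:
  assumes P: "is_product C p1 p2 X Y" and f: "f \<in> Hom C Z X" and g: "g \<in> Hom C Z Y" and h: "h \<in> Hom C W Z"
  shows "tuple C p1 p2 f g \<odot> h = tuple C p1 p2 (f \<odot> h) (g \<odot> h)"
proof -
  note [simp] = productD[OF P] HomD[OF f] HomD[OF g] HomD[OF h]
  note t = tuple_props[OF P f g]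
  note [simp] = HomD[OF t(1)]
  have fh: "f \<odot> h \<in> Hom C W X" and gh: "g \<odot> h \<in> Hom C W Y" by auto
  note s = tuple_props[OF P fh gh]
  show ?thesis
    by (rule product_eq[OF P _ s(1)]) (simp_all add: s(2,3) precomp_eq[OF t(2)] precomp_eq[OF t(3)])
qed

text \<open>
  A regular epimorphism factors through a subobject of its codomain only if that subobject is
  everything; in a regular category this extremality characterizes the regular epimorphisms, and
  it is the form in which they are easiest to compose and to cancel.
\<close>

definition extremal_epi :: "'m \<Rightarrow> bool" where
  "extremal_epi f \<longleftrightarrow> f \<in> Arr C \<and>
    (\<forall>m. \<forall>h \<in> Hom C (Dom C f) (Dom C m). is_mono C m \<and> Cod C m = Cod C f \<and> m \<odot> h = f \<longrightarrow> is_iso C m)"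

lemma extremal_epiD:
  assumes "extremal_epi f" "is_mono C m" "m \<odot> h = f" "h \<in> Hom C W (Dom C m)"
  shows "is_iso C m"
proof -
  note [simp] = HomD[OF assms(4)]
  have [simp]: "m \<in> Arr C" using assms(2) by (simp add: is_mono_def)
  have "Dom C f = W" "Cod C f = Cod C m" unfolding assms(3)[symmetric] by simp_all
  then have "h \<in> Hom C (Dom C f) (Dom C m)" "Cod C m = Cod C f" by simp_all
  with assms show ?thesis unfolding extremal_epi_def by blast
qed


lemma regular_epi_arr [simp]: "regular_epi C e \<Longrightarrow> e \<in> Arr C"
  unfolding regular_epi_def is_coequalizer_def by blast

lemma regular_epi_cancel_right:
  assumes e: "regular_epi C e" and g: "g \<in> Hom C (Cod C e) Z" and h: "h \<in> Hom C (Cod C e) Z"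
    and eq: "g \<odot> e = h \<odot> e"
  shows "g = h"
proof -
  obtain a b where q: "is_coequalizer C e a b" using e unfolding regular_epi_def by blast
  then have [simp]: "a \<in> Arr C" "b \<in> Arr C" "e \<in> Arr C" "Dom C b = Dom C a"
    "Cod C b = Cod C a" "Dom C e = Cod C a" and ab: "e \<odot> a = e \<odot> b"
    unfolding is_coequalizer_def by auto
  note [simp] = HomD[OF g] HomD[OF h]
  have "(g \<odot> e) \<odot> a = (g \<odot> e) \<odot> b" by (simp add: ab)
  moreover have "g \<odot> e \<in> Hom C (Cod C a) Z" by simp
  ultimately have "\<exists>!k. k \<in> Hom C (Cod C e) Z \<and> k \<odot> e = g \<odot> e"
    using q unfolding is_coequalizer_def by blast
  then show ?thesis by (rule Ex1_at_most_one) (use g h eq in simp_all)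
qed

lemma regular_epi_extremal:
  assumes e: "regular_epi C e"
  shows "extremal_epi e"
  unfolding extremal_epi_def
proof (intro conjI allI ballI impI)
  show "e \<in> Arr C" using e by simp
  fix m h assume h: "h \<in> Hom C (Dom C e) (Dom C m)" and m: "is_mono C m \<and> Cod C m = Cod C e \<and> m \<odot> h = e"
  obtain a b where q: "is_coequalizer C e a b" using e unfolding regular_epi_def by blast
  then have [simp]: "a \<in> Arr C" "b \<in> Arr C" "e \<in> Arr C" "Dom C b = Dom C a"
    "Cod C b = Cod C a" "Dom C e = Cod C a" and ab: "e \<odot> a = e \<odot> b"
    unfolding is_coequalizer_def by auto
  note [simp] = HomD[OF h]
  have [simp]: "m \<in> Arr C" "Cod C m = Cod C e" using m by (simp_all add: is_mono_def)
  have mh: "m \<odot> h = e" using m by simp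
  have "m \<odot> (h \<odot> a) = m \<odot> (h \<odot> b)"
    using ab by (simp add: precomp_eq[OF mh])
  from mono_cancel[OF _ this, of "Dom C a"] have "h \<odot> a = h \<odot> b"
    using m by simp
  moreover have "h \<in> Hom C (Cod C a) (Dom C m)" by simp
  ultimately obtain k where k: "k \<in> Hom C (Cod C e) (Dom C m)" "k \<odot> e = h"
    using q unfolding is_coequalizer_def by blast
  note [simp] = HomD[OF k(1)]
  have "m \<odot> k = Id C (Cod C e)"
    by (rule regular_epi_cancel_right[OF e, of _ "Cod C e"]) (simp_all add: k(2) mh)
  with m k show "is_iso C m" by (intro mono_split_iso[of m k]) auto
qed

lemma extremal_epi_comp:
  assumes pb: "\<And>f g. f \<in> Arr C \<Longrightarrow> g \<in> Arr C \<Longrightarrow> Cod C f = Cod C g \<Longrightarrow> \<exists>p q. is_pullback C p q f g"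
    and f: "extremal_epi f" and g: "extremal_epi g" and fg: "Cod C f = Dom C g"
  shows "extremal_epi (g \<odot> f)"
  unfolding extremal_epi_def
proof (intro conjI allI ballI impI)
  have [simp]: "f \<in> Arr C" "g \<in> Arr C" "Cod C f = Dom C g" using f g fg by (auto simp: extremal_epi_def)
  show "g \<odot> f \<in> Arr C" by simp
  fix m h assume h: "h \<in> Hom C (Dom C (g \<odot> f)) (Dom C m)"
    and m: "is_mono C m \<and> Cod C m = Cod C (g \<odot> f) \<and> m \<odot> h = g \<odot> f"
  note [simp] = HomD[OF h, simplified]
  have [simp]: "m \<in> Arr C" "Cod C m = Cod C g" and mh: "m \<odot> h = g \<odot> f"
    using m by (simp_all add: is_mono_def)
  obtain p q where P: "is_pullback C p q g m" using pb[of g m] by auto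
  note [simp] = pullbackD[OF P]
  have "f \<in> Hom C (Dom C f) (Dom C g)" "h \<in> Hom C (Dom C f) (Dom C m)" by simp_all
  from pullback_lift[OF P this mh[symmetric]]
  obtain k where k: "k \<in> Hom C (Dom C f) (Dom C p)" "p \<odot> k = f" "q \<odot> k = h" by blast
  have "is_mono C p" using pullback_mono[OF P] m by simp
  then have "is_iso C p" using extremal_epiD[OF f _ k(2,1)] by blast
  then obtain r where r: "r \<in> Hom C (Dom C g) (Dom C p)" "p \<odot> r = Id C (Dom C g)"
    by (rule is_iso_inverse) simp
  note [simp] = HomD[OF r(1)]
  have "m \<odot> (q \<odot> r) = g"
    using precomp_eq[OF pullback_square(1)[OF P, symmetric], of r] r(2) by simp
  with m show "is_iso C m" using extremal_epiD[OF g, of m "q \<odot> r"] by simp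
qed

lemma extremal_epi_cancel_left:
  assumes "extremal_epi (g \<odot> f)" and [simp]: "f \<in> Arr C" "g \<in> Arr C" "Cod C f = Dom C g"
  shows "extremal_epi g"
  unfolding extremal_epi_def
proof (intro conjI allI ballI impI)
  show "g \<in> Arr C" by simp
  fix m h assume h: "h \<in> Hom C (Dom C g) (Dom C m)" and m: "is_mono C m \<and> Cod C m = Cod C g \<and> m \<odot> h = g"
  note [simp] = HomD[OF h]
  have [simp]: "m \<in> Arr C" "Cod C m = Cod C g" and mh: "m \<odot> h = g"
    using m by (simp_all add: is_mono_def)
  have "m \<odot> (h \<odot> f) = g \<odot> f" by (simp add: precomp_eq[OF mh])
  with m show "is_iso C m" using extremal_epiD[OF assms(1), of m "h \<odot> f"] by simp
qed

lemma extremal_epi_id: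
  assumes [simp]: "X \<in> Obj C"
  shows "extremal_epi (Id C X)"
  unfolding extremal_epi_def
proof (intro conjI allI ballI impI)
  fix m h assume "h \<in> Hom C (Dom C (Id C X)) (Dom C m)"
    and "is_mono C m \<and> Cod C m = Cod C (Id C X) \<and> m \<odot> h = Id C X"
  then show "is_iso C m" by (intro mono_split_iso[of m h]) simp_all
qed simp

lemma regular_epi_iso:
  assumes e: "regular_epi C e" and m: "is_iso C m" and em: "Cod C e = Dom C m"
  shows "regular_epi C (m \<odot> e)"
proof -
  obtain a b where q: "is_coequalizer C e a b" using e unfolding regular_epi_def by blast
  then have [simp]: "a \<in> Arr C" "b \<in> Arr C" "e \<in> Arr C" "Dom C b = Dom C a"
    "Cod C b = Cod C a" "Dom C e = Cod C a" "Cod C e = Dom C m" and ab: "e \<odot> a = e \<odot> b"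
    using em unfolding is_coequalizer_def by auto
  have [simp]: "m \<in> Arr C" using m by (simp add: is_iso_def)
  obtain n where n: "n \<in> Hom C (Cod C m) (Dom C m)" "n \<odot> m = Id C (Dom C m)" "m \<odot> n = Id C (Cod C m)"
    using m by (rule is_iso_inverse)
  note [simp] = HomD[OF n(1)]
  have "is_coequalizer C (m \<odot> e) a b"
    unfolding is_coequalizer_def
  proof (intro conjI allI ballI impI)
    fix Z x assume x: "x \<in> Hom C (Cod C a) Z" "x \<odot> a = x \<odot> b"
    note [simp] = HomD[OF x(1)]
    have "\<exists>!h. h \<in> Hom C (Cod C e) Z \<and> h \<odot> e = x" using q x unfolding is_coequalizer_def by blast
    then obtain h where h: "h \<in> Hom C (Cod C e) Z" "h \<odot> e = x" by blast
    note [simp] = HomD[OF h(1), simplified]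
    show "\<exists>!h. h \<in> Hom C (Cod C (m \<odot> e)) Z \<and> h \<odot> (m \<odot> e) = x"
    proof (rule ex1I[of _ "h \<odot> n"])
      show "h \<odot> n \<in> Hom C (Cod C (m \<odot> e)) Z \<and> (h \<odot> n) \<odot> (m \<odot> e) = x"
        by (simp add: precomp_eq[OF n(2)] h(2))
      fix k assume k: "k \<in> Hom C (Cod C (m \<odot> e)) Z \<and> k \<odot> (m \<odot> e) = x"
      then have [simp]: "k \<in> Arr C" "Dom C k = Cod C m" "Cod C k = Z" by auto
      have "k \<odot> m = h"
        by (rule regular_epi_cancel_right[OF e, of _ Z]) (use k h in simp_all)
      then show "k = h \<odot> n" using n(3) by (auto simp: precomp_eq[OF _ _ _ _ \<open>n \<in> Arr C\<close>])
    qed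
  qed (simp_all add: ab)
  then show ?thesis unfolding regular_epi_def by blast
qed

lemma regular_epi_factor:
  assumes e: "regular_epi C e" and K: "kernel_pair C n1 n2 e"
    and g: "g \<in> Hom C (Dom C e) Z" "g \<odot> n1 = g \<odot> n2"
  obtains t where "t \<in> Hom C (Cod C e) Z" "t \<odot> e = g"
proof -
  obtain a b where q: "is_coequalizer C e a b" using e unfolding regular_epi_def by blast
  then have [simp]: "a \<in> Arr C" "b \<in> Arr C" "e \<in> Arr C" "Dom C b = Dom C a"
    "Cod C b = Cod C a" "Dom C e = Cod C a" and ab: "e \<odot> a = e \<odot> b"
    unfolding is_coequalizer_def by auto
  note [simp] = pullbackD[OF K, simplified] HomD[OF g(1), simplified]
  have "a \<in> Hom C (Dom C a) (Dom C e)" "b \<in> Hom C (Dom C a) (Dom C e)" by simp_all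
  from pullback_lift[OF K this ab] obtain h where
    h: "h \<in> Hom C (Dom C a) (Dom C n1)" "n1 \<odot> h = a" "n2 \<odot> h = b" by blast
  note [simp] = HomD[OF h(1)]
  have "g \<odot> a = g \<odot> b" using precomp_eq[OF g(2), of h] h(2,3) by simp
  moreover have "g \<in> Hom C (Cod C a) Z" by simp
  ultimately have "\<exists>!t. t \<in> Hom C (Cod C e) Z \<and> t \<odot> e = g"
    using q unfolding is_coequalizer_def by blast
  with that show thesis by blast
qed

lemma kernel_pair_cancel_mono:
  assumes K: "kernel_pair C p q (m \<odot> f)" and m: "is_mono C m" and [simp]: "f \<in> Arr C" "Cod C f = Dom C m"
  shows "kernel_pair C p q f"
proof -
  have [simp]: "m \<in> Arr C" using m by (simp add: is_mono_def)
  note [simp] = pullbackD[OF K, simplified]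
  have "m \<odot> (f \<odot> p) = m \<odot> (f \<odot> q)" using pullback_square(1)[OF K] by simp
  from mono_cancel[OF m this, of "Dom C p"] have fpq: "f \<odot> p = f \<odot> q" by simp
  have "\<exists>!h. h \<in> Hom C Z (Dom C p) \<and> p \<odot> h = x \<and> q \<odot> h = y"
    if x: "x \<in> Hom C Z (Dom C f)" and y: "y \<in> Hom C Z (Dom C f)" and xy: "f \<odot> x = f \<odot> y" for Z x y
  proof -
    note [simp] = HomD[OF x] HomD[OF y]
    obtain h where h: "h \<in> Hom C Z (Dom C p)" "p \<odot> h = x" "q \<odot> h = y"
      by (rule pullback_lift[OF K, of x Z y]) (simp_all add: xy)
    moreover have "h' = h" if "h' \<in> Hom C Z (Dom C p)" "p \<odot> h' = x" "q \<odot> h' = y" for h'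
      by (rule pullback_eq[OF K that(1) h(1)]) (use h that in simp_all)
    ultimately show ?thesis by blast
  qed
  then have "\<forall>Z. \<forall>x \<in> Hom C Z (Dom C f). \<forall>y \<in> Hom C Z (Dom C f). f \<odot> x = f \<odot> y \<longrightarrow>
      (\<exists>!h. h \<in> Hom C Z (Dom C p) \<and> p \<odot> h = x \<and> q \<odot> h = y)"
    by blast
  with fpq show ?thesis unfolding is_pullback_def by simp
qed

end

section \<open>Regular categories\<close>

locale regular_cat = category C for C :: "('o, 'm) cat" (structure) +
  assumes regular: "regular_category C"
begin

lemma pullback_exists:
  assumes "f \<in> Arr C" "g \<in> Arr C" "Cod C f = Cod C g"
  shows "\<exists>p q. is_pullback C p q f g"
  using regular assms unfolding regular_category_def finitely_complete_def by blast

lemma regular_epi_pullback: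
  assumes "is_pullback C p q f g" "regular_epi C g"
  shows "regular_epi C p"
  using regular assms unfolding regular_category_def by blast

text \<open>
  Pullback stability says that a regular epimorphism can be treated as a surjection: every
  generalized element of its codomain lifts to its domain after a change of stage along another
  regular epimorphism.
\<close>

lemma regular_epi_lift:
  assumes e: "regular_epi C e" and y: "y \<in> Hom C W (Cod C e)"
  obtains V c x where "c \<in> Hom C V W" "regular_epi C c" "x \<in> Hom C V (Dom C e)" "e \<odot> x = y \<odot> c"
proof -
  note [simp] = HomD[OF y]
  obtain c x where P: "is_pullback C c x y e" using pullback_exists[of y e] e by auto
  with regular_epi_pullback[OF P e] that[of c "Dom C c" x] pullbackD[OF P] pullback_square(1)[OF P, symmetric]
  show thesis by simp
qed

lemma image_factorization:
  assumes f: "f \<in> Hom C X Y"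
  obtains I e m where "e \<in> Hom C X I" "regular_epi C e" "m \<in> Hom C I Y" "is_mono C m" "m \<odot> e = f"
proof -
  note [simp] = HomD[OF f]
  obtain p q where K: "is_pullback C p q f f" using pullback_exists[of f f] by auto
  note [simp] = pullbackD[OF K, simplified]
  obtain e where q: "is_coequalizer C e p q" using regular K unfolding regular_category_def by blast
  then have e: "regular_epi C e" unfolding regular_epi_def by blast
  from q have [simp]: "e \<in> Arr C" "Dom C e = X" and pq: "e \<odot> p = e \<odot> q"
    unfolding is_coequalizer_def by auto
  have "f \<in> Hom C (Cod C p) Y" by simp
  then have "\<exists>!m. m \<in> Hom C (Cod C e) Y \<and> m \<odot> e = f"
    using q pullback_square(1)[OF K] unfolding is_coequalizer_def by blast
  then obtain m where m: "m \<in> Hom C (Cod C e) Y" "m \<odot> e = f" by blast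
  note [simp] = HomD[OF m(1)]
  have "is_mono C m"
    unfolding is_mono_def
  proof (intro conjI allI ballI impI)
    fix Z x y assume x: "x \<in> Hom C Z (Dom C m)" and y: "y \<in> Hom C Z (Dom C m)" and xy: "m \<odot> x = m \<odot> y"
    note [simp] = HomD[OF x, simplified] HomD[OF y, simplified]
    have "x \<in> Hom C Z (Cod C e)" by simp
    from regular_epi_lift[OF e this] obtain V c x' where
      c: "c \<in> Hom C V Z" "regular_epi C c" and x': "x' \<in> Hom C V (Dom C e)" "e \<odot> x' = x \<odot> c" by blast
    note [simp] = HomD[OF c(1)] HomD[OF x'(1), simplified]
    have "y \<odot> c \<in> Hom C V (Cod C e)" by simp
    from regular_epi_lift[OF e this] obtain V' c' y' where
      c': "c' \<in> Hom C V' V" "regular_epi C c'" and y': "y' \<in> Hom C V' (Dom C e)" "e \<odot> y' = (y \<odot> c) \<odot> c'" by blast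
    note [simp] = HomD[OF c'(1)] HomD[OF y'(1), simplified]
    have "f \<odot> (x' \<odot> c') = m \<odot> (e \<odot> (x' \<odot> c'))" by (simp add: precomp_eq[OF m(2)])
    also have "\<dots> = m \<odot> (e \<odot> y')"
      using precomp_eq[OF x'(2), of c'] y'(2) precomp_eq[OF xy, of "c \<odot> c'"] by simp
    also have "\<dots> = f \<odot> y'" by (simp add: precomp_eq[OF m(2)])
    finally have 1: "f \<odot> (x' \<odot> c') = f \<odot> y'" .
    have "x' \<odot> c' \<in> Hom C V' (Dom C f)" "y' \<in> Hom C V' (Dom C f)" by simp_all
    from pullback_lift[OF K this 1] obtain k where
      k: "k \<in> Hom C V' (Dom C p)" "p \<odot> k = x' \<odot> c'" "q \<odot> k = y'" by blast
    note [simp] = HomD[OF k(1)]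
    have "e \<odot> (x' \<odot> c') = e \<odot> y'"
      using precomp_eq[OF pq, of k] k by simp
    then have "(x \<odot> c) \<odot> c' = (y \<odot> c) \<odot> c'"
      using precomp_eq[OF x'(2), of c'] y'(2) by simp
    from regular_epi_cancel_right[OF c'(2) _ _ this, of "Cod C e"] have "x \<odot> c = y \<odot> c"
      by simp
    from regular_epi_cancel_right[OF c(2) _ _ this, of "Cod C e"] show "x = y"
      by simp
  qed simp
  with that[of e "Cod C e" m] e m show thesis by simp
qed

lemma regular_epi_iff_extremal: "regular_epi C e \<longleftrightarrow> extremal_epi e"
proof
  assume e: "extremal_epi e"
  then have [simp]: "e \<in> Arr C" by (simp add: extremal_epi_def)
  have "e \<in> Hom C (Dom C e) (Cod C e)" by simp
  then obtain I q m where *: "q \<in> Hom C (Dom C e) I" "regular_epi C q" "m \<in> Hom C I (Cod C e)" "is_mono C m" "m \<odot> q = e"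
    by (rule image_factorization)
  then have "is_iso C m" using extremal_epiD[OF e, of m q] by simp
  with regular_epi_iso[OF *(2), of m] * show "regular_epi C e" by simp
qed (rule regular_epi_extremal)

lemma regular_epi_comp:
  "regular_epi C f \<Longrightarrow> regular_epi C g \<Longrightarrow> Cod C f = Dom C g \<Longrightarrow> regular_epi C (g \<odot> f)"
  unfolding regular_epi_iff_extremal by (rule extremal_epi_comp[OF pullback_exists])

lemma regular_epi_cancel_left:
  "regular_epi C (g \<odot> f) \<Longrightarrow> f \<in> Arr C \<Longrightarrow> g \<in> Arr C \<Longrightarrow> Cod C f = Dom C g \<Longrightarrow> regular_epi C g"
  unfolding regular_epi_iff_extremal by (rule extremal_epi_cancel_left)

lemma regular_epi_split:
  assumes "p \<in> Hom C X Y" "s \<in> Hom C Y X" "p \<odot> s = Id C Y"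
  shows "regular_epi C p"
proof -
  note [simp] = HomD[OF assms(1)] HomD[OF assms(2)]
  have "regular_epi C (p \<odot> s)"
    unfolding regular_epi_iff_extremal assms(3) by (rule extremal_epi_id) simp
  then show ?thesis by (rule regular_epi_cancel_left) simp_all
qed

lemma regular_epi_mono_iso:
  assumes "regular_epi C (m \<odot> h)" "is_mono C m" "h \<in> Hom C W (Dom C m)"
  shows "is_iso C m"
proof -
  have "m \<in> Arr C" using assms(2) by (simp add: is_mono_def)
  then show ?thesis using assms extremal_epiD[of "m \<odot> h" m h] unfolding regular_epi_iff_extremal by simp
qed

end

section \<open>Semi-abelian categories\<close>

locale semi_abelian_cat = regular_cat C for C :: "('o, 'm) cat" (structure) +
  assumes semi_abelian: "semi_abelian C"
begin

definition zob :: 'o where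
  "zob = (SOME Z. zero_object C Z)"

definition zer :: "'o \<Rightarrow> 'o \<Rightarrow> 'm" where
  "zer X Y = (THE h. h \<in> Hom C zob Y) \<odot> (THE g. g \<in> Hom C X zob)"

lemma zero_object_zob: "zero_object C zob"
  using semi_abelian someI_ex[of "zero_object C"] unfolding semi_abelian_def pointed_def zob_def by blast

lemma zob_obj [simp]: "zob \<in> Obj C"
  using zero_object_zob unfolding zero_object_def initial_object_def by blast

lemma to_zob_eq: "f \<in> Hom C X zob \<Longrightarrow> g \<in> Hom C X zob \<Longrightarrow> f = g"
  using zero_object_zob HomD(4)[of f X zob] unfolding zero_object_def terminal_object_def by blast

lemma from_zob_eq: "f \<in> Hom C zob X \<Longrightarrow> g \<in> Hom C zob X \<Longrightarrow> f = g"
  using zero_object_zob HomD(5)[of f zob X] unfolding zero_object_def initial_object_def by blast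

lemma zer_factor:
  assumes "X \<in> Obj C" "Y \<in> Obj C"
  obtains g h where "g \<in> Hom C X zob" "h \<in> Hom C zob Y" "zer X Y = h \<odot> g"
proof -
  have "\<exists>!h. h \<in> Hom C zob Y" "\<exists>!g. g \<in> Hom C X zob"
    using zero_object_zob assms unfolding zero_object_def terminal_object_def initial_object_def by blast+
  from theI'[OF this(1)] theI'[OF this(2)] that show thesis unfolding zer_def by blast
qed

lemma zer_simps [simp]:
  assumes "X \<in> Obj C" "Y \<in> Obj C"
  shows "zer X Y \<in> Arr C" "Dom C (zer X Y) = X" "Cod C (zer X Y) = Y"
  using zer_factor[OF assms] by (metis HomD(1-3) comp_simps)+

lemma zer_eqI:
  assumes "g \<in> Hom C X zob" "h \<in> Hom C zob Y"
  shows "h \<odot> g = zer X Y"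
  using zer_factor[OF HomD(4)[OF assms(1)] HomD(5)[OF assms(2)]] assms to_zob_eq from_zob_eq by metis

lemma comp_zer [simp]:
  assumes "f \<in> Arr C" "Dom C f = Y" "X \<in> Obj C"
  shows "f \<odot> zer X Y = zer X (Cod C f)"
proof -
  have "Y \<in> Obj C" using assms by auto
  then obtain g h where *: "g \<in> Hom C X zob" "h \<in> Hom C zob Y" "zer X Y = h \<odot> g"
    using zer_factor assms(3) by blast
  note [simp] = HomD[OF *(1)] HomD[OF *(2)]
  have "f \<odot> zer X Y = (f \<odot> h) \<odot> g" using assms * by simp
  also have "\<dots> = zer X (Cod C f)" by (rule zer_eqI) (use assms in simp_all)
  finally show ?thesis .
qed

lemma zer_comp [simp]:
  assumes "f \<in> Arr C" "Cod C f = X" "Y \<in> Obj C"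
  shows "zer X Y \<odot> f = zer (Dom C f) Y"
proof -
  have "X \<in> Obj C" using assms by auto
  then obtain g h where *: "g \<in> Hom C X zob" "h \<in> Hom C zob Y" "zer X Y = h \<odot> g"
    using zer_factor assms(3) by blast
  note [simp] = HomD[OF *(1)] HomD[OF *(2)]
  have "zer X Y \<odot> f = h \<odot> (g \<odot> f)" using assms * by simp
  also have "\<dots> = zer (Dom C f) Y" by (rule zer_eqI) (use assms in simp_all)
  finally show ?thesis .
qed

lemma zero_arrow_iff: "zero_arrow C f \<longleftrightarrow> f \<in> Arr C \<and> f = zer (Dom C f) (Cod C f)"
proof
  assume "zero_arrow C f"
  then obtain Z g h where f: "f \<in> Arr C" and Z: "zero_object C Z"
    and gh: "g \<in> Hom C (Dom C f) Z" "h \<in> Hom C Z (Cod C f)" "f = h \<odot> g"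
    unfolding zero_arrow_def by blast
  note [simp] = HomD[OF gh(1)] HomD[OF gh(2)]
  have "g = zer (Dom C f) Z"
    using Z f unfolding zero_object_def terminal_object_def by (metis HomD(1) Hom_iff gh(1) dom_cod_obj(1) zer_simps)
  moreover have "h \<odot> zer (Dom C f) Z = zer (Dom C f) (Cod C f)" using f by simp
  ultimately show "f \<in> Arr C \<and> f = zer (Dom C f) (Cod C f)" using f gh(3) by metis
next
  assume f: "f \<in> Arr C \<and> f = zer (Dom C f) (Cod C f)"
  then obtain g h where "g \<in> Hom C (Dom C f) zob" "h \<in> Hom C zob (Cod C f)" "f = h \<odot> g"
    using zer_factor[of "Dom C f" "Cod C f"] by auto
  then show "zero_arrow C f" unfolding zero_arrow_def using f zero_object_zob by blast
qed

lemma kernel_exists: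
  assumes f: "f \<in> Hom C X Y"
  obtains k K where "is_kernel C k f" "k \<in> Hom C K X"
proof -
  note [simp] = HomD[OF f]
  obtain k q where P: "is_pullback C k q f (zer zob Y)" using pullback_exists[of f "zer zob Y"] by auto
  note [simp] = pullbackD[OF P, simplified]
  have "f \<odot> k = zer (Dom C k) Y" using pullback_square(1)[OF P] by simp
  moreover have "\<exists>!h. h \<in> Hom C Z (Dom C k) \<and> k \<odot> h = x"
    if x: "x \<in> Hom C Z X" "zero_arrow C (f \<odot> x)" for Z x
  proof -
    note [simp] = HomD[OF x(1)]
    have "zer Z zob \<in> Hom C Z (Dom C (zer zob Y))" "f \<odot> x = zer zob Y \<odot> zer Z zob"
      using x(2) zero_arrow_iff[of "f \<odot> x"] by simp_all
    with pullback_lift[OF P, of x Z "zer Z zob"] obtain h where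
      h: "h \<in> Hom C Z (Dom C k)" "k \<odot> h = x" by auto
    moreover have "h' = h" if h': "h' \<in> Hom C Z (Dom C k)" "k \<odot> h' = x" for h'
      by (rule pullback_eq[OF P h'(1) h(1)]) (use h h' in \<open>auto intro!: to_zob_eq[of _ Z]\<close>)
    ultimately show ?thesis by blast
  qed
  then have "\<forall>Z. \<forall>x \<in> Hom C Z (Dom C f). zero_arrow C (f \<odot> x) \<longrightarrow>
      (\<exists>!h. h \<in> Hom C Z (Dom C k) \<and> k \<odot> h = x)"
    unfolding \<open>Dom C f = X\<close> by blast
  ultimately have "is_kernel C k f" unfolding is_kernel_def zero_arrow_iff[of "f \<odot> k"] by simp
  with that[of k "Dom C k"] show thesis by simp
qed

lemma kernelD:
  assumes "is_kernel C k f"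
  shows "k \<in> Arr C" "f \<in> Arr C" "Cod C k = Dom C f" "f \<odot> k = zer (Dom C k) (Cod C f)"
  using assms unfolding is_kernel_def zero_arrow_iff by auto

lemma kernel_lift:
  assumes "is_kernel C k f" "x \<in> Hom C Z (Dom C f)" "f \<odot> x = zer Z (Cod C f)"
  obtains h where "h \<in> Hom C Z (Dom C k)" "k \<odot> h = x"
proof -
  note [simp] = kernelD[OF assms(1)] HomD[OF assms(2)]
  have "zero_arrow C (f \<odot> x)" unfolding zero_arrow_iff using assms(3) by simp
  then have "\<exists>!h. h \<in> Hom C Z (Dom C k) \<and> k \<odot> h = x"
    using assms(1,2) unfolding is_kernel_def by blast
  with that show thesis by blast
qed

lemma kernel_mono:
  assumes k: "is_kernel C k f"
  shows "is_mono C k"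
  unfolding is_mono_def
proof (intro conjI allI ballI impI)
  note [simp] = kernelD[OF k]
  show "k \<in> Arr C" by simp
  fix Z g h assume gh: "g \<in> Hom C Z (Dom C k)" "h \<in> Hom C Z (Dom C k)" "k \<odot> g = k \<odot> h"
  note [simp] = HomD[OF gh(1)] HomD[OF gh(2)]
  have "zero_arrow C (f \<odot> (k \<odot> h))"
    unfolding zero_arrow_iff using precomp_eq[OF kernelD(4)[OF k], of h] by simp
  moreover have "k \<odot> h \<in> Hom C Z (Dom C f)" by simp
  ultimately have "\<exists>!l. l \<in> Hom C Z (Dom C k) \<and> k \<odot> l = k \<odot> h"
    using k unfolding is_kernel_def by blast
  then show "g = h" by (rule Ex1_at_most_one) (use gh in simp_all)
qed

lemma product_exists:
  assumes [simp]: "X \<in> Obj C" "Y \<in> Obj C"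
  obtains p1 p2 where "is_product C p1 p2 X Y"
proof -
  obtain p q where P: "is_pullback C p q (zer X zob) (zer Y zob)"
    using pullback_exists[of "zer X zob" "zer Y zob"] by auto
  note [simp] = pullbackD[OF P, simplified]
  have "\<exists>!h. h \<in> Hom C Z (Dom C p) \<and> p \<odot> h = f \<and> q \<odot> h = g"
    if f: "f \<in> Hom C Z X" and g: "g \<in> Hom C Z Y" for Z f g
  proof -
    note [simp] = HomD[OF f] HomD[OF g]
    obtain h where h: "h \<in> Hom C Z (Dom C p)" "p \<odot> h = f" "q \<odot> h = g"
      by (rule pullback_lift[OF P, of f Z g]) simp_all
    moreover have "h' = h" if "h' \<in> Hom C Z (Dom C p)" "p \<odot> h' = f" "q \<odot> h' = g" for h'
      by (rule pullback_eq[OF P that(1) h(1)]) (use h that in simp_all)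
    ultimately show ?thesis by blast
  qed
  then have "\<forall>Z. \<forall>f \<in> Hom C Z X. \<forall>g \<in> Hom C Z Y.
      \<exists>!h. h \<in> Hom C Z (Dom C p) \<and> p \<odot> h = f \<and> q \<odot> h = g"
    by blast
  then have "is_product C p q X Y" unfolding is_product_def by simp
  with that show thesis .
qed

lemma short_five:
  assumes "regular_epi C p" "is_kernel C k p" "regular_epi C p'" "is_kernel C k' p'"
    "a \<in> Hom C (Dom C k) (Dom C k')" "v \<in> Hom C (Dom C p) (Dom C p')"
    "w \<in> Hom C (Cod C p) (Cod C p')" "k' \<odot> a = v \<odot> k" "p' \<odot> v = w \<odot> p"
    "is_iso C a" "is_iso C w"
  shows "is_iso C v"
  using semi_abelian assms unfolding semi_abelian_def protomodular_def by blast

lemma is_iso_id: "X \<in> Obj C \<Longrightarrow> is_iso C (Id C X)"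
  unfolding is_iso_def by (intro conjI bexI[of _ "Id C X"]) simp_all

text \<open>
  A property of the generalized elements of \<open>T\<close> is representable if it is membership in a
  subobject of \<open>T\<close>. Such properties can be proved by induction over generating elements.
\<close>

definition representable :: "'o \<Rightarrow> ('m \<Rightarrow> bool) \<Rightarrow> bool" where
  "representable T \<Phi> \<longleftrightarrow> (\<exists>m. is_mono C m \<and> Cod C m = T \<and>
     (\<forall>Z. \<forall>x \<in> Hom C Z T. \<Phi> x \<longleftrightarrow> (\<exists>y \<in> Hom C Z (Dom C m). m \<odot> y = x)))"

lemma representable_cong:
  assumes "\<And>Z x. x \<in> Hom C Z T \<Longrightarrow> \<Phi> x \<longleftrightarrow> \<Psi> x" "representable T \<Phi>"
  shows "representable T \<Psi>"
proof -
  obtain m where "is_mono C m" "Cod C m = T"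
    "\<forall>Z. \<forall>x \<in> Hom C Z T. \<Phi> x \<longleftrightarrow> (\<exists>y \<in> Hom C Z (Dom C m). m \<odot> y = x)"
    using assms(2) unfolding representable_def by blast
  moreover from this(3) assms(1)
  have "\<forall>Z. \<forall>x \<in> Hom C Z T. \<Psi> x \<longleftrightarrow> (\<exists>y \<in> Hom C Z (Dom C m). m \<odot> y = x)"
    by blast
  ultimately show ?thesis unfolding representable_def by blast
qed

lemma representable_factor:
  assumes "is_mono C m" "Cod C m = T"
  shows "representable T (\<lambda>x. \<exists>y \<in> Hom C (Dom C x) (Dom C m). m \<odot> y = x)"
  unfolding representable_def using assms by (intro exI[of _ m]) simp

lemma representable_iso:
  assumes "is_iso C m" "x \<in> Hom C Z (Cod C m)"
  shows "\<exists>y \<in> Hom C Z (Dom C m). m \<odot> y = x"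
proof -
  have [simp]: "m \<in> Arr C" using assms by (simp add: is_iso_def)
  obtain n where n: "n \<in> Hom C (Cod C m) (Dom C m)" "n \<odot> m = Id C (Dom C m)" "m \<odot> n = Id C (Cod C m)"
    using assms(1) by (rule is_iso_inverse)
  note [simp] = HomD[OF n(1)] HomD[OF assms(2)]
  show ?thesis by (rule bexI[of _ "n \<odot> x"]) (simp_all add: precomp_eq[OF n(3)])
qed

lemma representable_regular_epi:
  assumes R: "representable T \<Phi>" and e: "regular_epi C e" "e \<in> Hom C W T" "\<Phi> e" and x: "x \<in> Hom C Z T"
  shows "\<Phi> x"
proof -
  obtain m where m: "is_mono C m" "Cod C m = T"
    and \<Phi>: "\<And>Z x. x \<in> Hom C Z T \<Longrightarrow> \<Phi> x \<longleftrightarrow> (\<exists>y \<in> Hom C Z (Dom C m). m \<odot> y = x)"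
    using R unfolding representable_def by blast
  obtain y where "y \<in> Hom C W (Dom C m)" "m \<odot> y = e" using \<Phi>[OF e(2)] e(3) by blast
  with regular_epi_mono_iso[of m y] m e have "is_iso C m" by simp
  with representable_iso[of m x Z] m x \<Phi>[OF x] show ?thesis by blast
qed

text \<open>
  Protomodularity as an induction principle: to verify a representable property it suffices to
  verify it on the kernel of a map \<open>p\<close> and on one generalized element whose image under \<open>p\<close> is a
  regular epimorphism. The subobject in question then has the same kernel and the same image
  under \<open>p\<close> as the whole object, so the Short Five Lemma identifies the two.
\<close>

lemma representable_extension:
  assumes R: "representable T \<Phi>" and p: "p \<in> Hom C T B" and y: "y \<in> Hom C W T" "\<Phi> y" "regular_epi C (p \<odot> y)"
    and ker: "\<And>Z x. x \<in> Hom C Z T \<Longrightarrow> p \<odot> x = zer Z B \<Longrightarrow> \<Phi> x"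
    and x: "x \<in> Hom C Z T"
  shows "\<Phi> x"
proof -
  obtain m where m: "is_mono C m" "Cod C m = T"
    and \<Phi>: "\<And>Z x. x \<in> Hom C Z T \<Longrightarrow> \<Phi> x \<longleftrightarrow> (\<exists>y \<in> Hom C Z (Dom C m). m \<odot> y = x)"
    using R unfolding representable_def by blast
  note [simp] = HomD[OF p] HomD[OF y(1)] m(2)
  have [simp]: "m \<in> Arr C" using m by (simp add: is_mono_def)
  obtain y' where y': "y' \<in> Hom C W (Dom C m)" "m \<odot> y' = y" using \<Phi>[OF y(1)] y(2) by blast
  note [simp] = HomD[OF y'(1)]
  have p_epi: "regular_epi C p" by (rule regular_epi_cancel_left[OF y(3)]) simp_all
  have pm_epi: "regular_epi C (p \<odot> m)"
    by (rule regular_epi_cancel_left[of _ y']) (use y(3) y'(2) in simp_all)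
  obtain k K where k: "is_kernel C k p" "k \<in> Hom C K T" using p by (rule kernel_exists)
  note [simp] = HomD[OF k(2)]
  have pk: "p \<odot> k = zer K B" using kernelD(4)[OF k(1)] by simp
  obtain k' where k': "k' \<in> Hom C K (Dom C m)" "m \<odot> k' = k" using \<Phi>[OF k(2)] ker[OF k(2) pk] by blast
  note [simp] = HomD[OF k'(1)]
  have "is_kernel C k' (p \<odot> m)"
    unfolding is_kernel_def zero_arrow_iff
  proof (intro conjI allI ballI impI)
    show "(p \<odot> m) \<odot> k' = zer (Dom C ((p \<odot> m) \<odot> k')) (Cod C ((p \<odot> m) \<odot> k'))"
      using pk k' by simp
    fix Z z assume z: "z \<in> Hom C Z (Dom C (p \<odot> m))"
      and pz: "(p \<odot> m) \<odot> z \<in> Arr C \<and> (p \<odot> m) \<odot> z = zer (Dom C ((p \<odot> m) \<odot> z)) (Cod C ((p \<odot> m) \<odot> z))"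
    note [simp] = HomD[OF z, simplified]
    have "m \<odot> z \<in> Hom C Z (Dom C p)" "p \<odot> (m \<odot> z) = zer Z (Cod C p)" using pz by simp_all
    from kernel_lift[OF k(1) this] obtain h where h: "h \<in> Hom C Z (Dom C k)" "k \<odot> h = m \<odot> z" by blast
    note [simp] = HomD[OF h(1), simplified]
    have "m \<odot> (k' \<odot> h) = m \<odot> z" using h by (simp add: precomp_eq[OF k'(2)])
    from mono_cancel[OF m(1) this, of Z] have kh: "k' \<odot> h = z" by simp
    show "\<exists>!h. h \<in> Hom C Z (Dom C k') \<and> k' \<odot> h = z"
    proof (rule ex1I[of _ h])
      show "h \<in> Hom C Z (Dom C k') \<and> k' \<odot> h = z" using kh by simp
      fix l assume l: "l \<in> Hom C Z (Dom C k') \<and> k' \<odot> l = z"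
      then have [simp]: "l \<in> Arr C" "Dom C l = Z" "Cod C l = K" by simp_all
      have "k \<odot> l = k \<odot> h"
        using l h by (simp add: precomp_eq[OF k'(2), symmetric])
      from mono_cancel[OF kernel_mono[OF k(1)] this, of Z] show "l = h" by simp
    qed
  qed simp_all
  then have "is_iso C m"
    by (rule short_five[OF pm_epi _ p_epi k(1), of _ "Id C K" _ "Id C B"])
       (simp_all add: k'(2) is_iso_id)
  with representable_iso[of m x Z] m x \<Phi>[OF x] show ?thesis by simp
qed

lemma representable_point:
  assumes "representable T \<Phi>" "p \<in> Hom C T B" "s \<in> Hom C B T" "p \<odot> s = Id C B" "\<Phi> s"
    and "\<And>Z x. x \<in> Hom C Z T \<Longrightarrow> p \<odot> x = zer Z B \<Longrightarrow> \<Phi> x"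
    and "x \<in> Hom C Z T"
  shows "\<Phi> x"
proof (rule representable_extension[OF assms(1,2,3,5) _ assms(6,7)])
  have "B \<in> Obj C" using HomD(5)[OF assms(2)] .
  then show "regular_epi C (p \<odot> s)"
    unfolding assms(4) regular_epi_iff_extremal by (rule extremal_epi_id)
qed

definition jointly_monic :: "'m \<Rightarrow> 'm \<Rightarrow> bool" where
  "jointly_monic s1 s2 \<longleftrightarrow> (\<forall>Z. \<forall>g \<in> Hom C Z (Dom C s1). \<forall>h \<in> Hom C Z (Dom C s1).
     s1 \<odot> g = s1 \<odot> h \<and> s2 \<odot> g = s2 \<odot> h \<longrightarrow> g = h)"

lemma jointly_monicD:
  assumes "jointly_monic s1 s2" "s1 \<odot> g = s1 \<odot> h" "s2 \<odot> g = s2 \<odot> h"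
    "g \<in> Hom C Z (Dom C s1)" "h \<in> Hom C Z (Dom C s1)"
  shows "g = h"
  using assms unfolding jointly_monic_def by blast

text \<open>
  The property of being related by an internal relation \<open>S\<close> after applying \<open>a\<close> and \<open>b\<close> is
  represented by the pullback of \<open>S\<close> along \<open>\<langle>a, b\<rangle>\<close>.
\<close>

lemma representable_relation:
  assumes s: "s1 \<in> Hom C S Y" "s2 \<in> Hom C S Y" "jointly_monic s1 s2"
    and a: "a \<in> Hom C T Y" and b: "b \<in> Hom C T Y"
  shows "representable T (\<lambda>x. \<exists>r \<in> Hom C (Dom C x) S. s1 \<odot> r = a \<odot> x \<and> s2 \<odot> r = b \<odot> x)"
proof -
  note [simp] = HomD[OF s(1)] HomD[OF s(2)] HomD[OF a] HomD[OF b]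
  obtain p1 p2 where P: "is_product C p1 p2 Y Y" using product_exists[of Y Y] by auto
  note [simp] = productD[OF P]
  define \<sigma> where "\<sigma> = tuple C p1 p2 s1 s2"
  define \<alpha> where "\<alpha> = tuple C p1 p2 a b"
  note \<sigma> = tuple_props[OF P s(1,2), folded \<sigma>_def]
  note \<alpha> = tuple_props[OF P a b, folded \<alpha>_def]
  note [simp] = HomD[OF \<sigma>(1)] HomD[OF \<alpha>(1)]
  have \<sigma>_mono: "is_mono C \<sigma>"
    unfolding is_mono_def
  proof (intro conjI allI ballI impI)
    fix Z g h assume gh: "g \<in> Hom C Z (Dom C \<sigma>)" "h \<in> Hom C Z (Dom C \<sigma>)" "\<sigma> \<odot> g = \<sigma> \<odot> h"
    note [simp] = HomD[OF gh(1), simplified] HomD[OF gh(2), simplified]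
    have "s1 \<odot> g = s1 \<odot> h" "s2 \<odot> g = s2 \<odot> h"
      using gh(3) precomp_eq[OF \<sigma>(2), of g] precomp_eq[OF \<sigma>(2), of h]
        precomp_eq[OF \<sigma>(3), of g] precomp_eq[OF \<sigma>(3), of h] by simp_all
    from jointly_monicD[OF s(3) this, of Z] show "g = h" by simp
  qed simp
  obtain m q where Q: "is_pullback C m q \<alpha> \<sigma>" using pullback_exists[of \<alpha> \<sigma>] by auto
  note [simp] = pullbackD[OF Q, simplified]
  have "(\<exists>r \<in> Hom C (Dom C x) S. s1 \<odot> r = a \<odot> x \<and> s2 \<odot> r = b \<odot> x) \<longleftrightarrow>
      (\<exists>y \<in> Hom C Z (Dom C m). m \<odot> y = x)" if x: "x \<in> Hom C Z T" for Z x
  proof -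
    note [simp] = HomD[OF x]
    show ?thesis
    proof
      assume "\<exists>r \<in> Hom C (Dom C x) S. s1 \<odot> r = a \<odot> x \<and> s2 \<odot> r = b \<odot> x"
      then obtain r where r: "r \<in> Hom C Z S" "s1 \<odot> r = a \<odot> x" "s2 \<odot> r = b \<odot> x" by auto
      note [simp] = HomD[OF r(1)]
      have "\<alpha> \<odot> x = \<sigma> \<odot> r"
        by (rule product_eq[OF P, of _ Z])
           (simp_all add: precomp_eq[OF \<sigma>(2)] precomp_eq[OF \<sigma>(3)] precomp_eq[OF \<alpha>(2)] precomp_eq[OF \<alpha>(3)] r)
      then obtain y where "y \<in> Hom C Z (Dom C m)" "m \<odot> y = x"
        by (rule pullback_lift[OF Q, of x Z r, rotated 2]) simp_all
      then show "\<exists>y \<in> Hom C Z (Dom C m). m \<odot> y = x" by blast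
    next
      assume "\<exists>y \<in> Hom C Z (Dom C m). m \<odot> y = x"
      then obtain y where y: "y \<in> Hom C Z (Dom C m)" "m \<odot> y = x" by blast
      note [simp] = HomD[OF y(1)]
      have "\<alpha> \<odot> x = \<sigma> \<odot> (q \<odot> y)"
        using precomp_eq[OF pullback_square(1)[OF Q], of y] y(2) by simp
      then have "s1 \<odot> (q \<odot> y) = a \<odot> x" "s2 \<odot> (q \<odot> y) = b \<odot> x"
        using precomp_eq[OF \<sigma>(2), of "q \<odot> y"] precomp_eq[OF \<sigma>(3), of "q \<odot> y"]
          precomp_eq[OF \<alpha>(2), of x] precomp_eq[OF \<alpha>(3), of x] by simp_all
      then show "\<exists>r \<in> Hom C (Dom C x) S. s1 \<odot> r = a \<odot> x \<and> s2 \<odot> r = b \<odot> x"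
        by (intro bexI[of _ "q \<odot> y"]) simp_all
    qed
  qed
  then have "\<forall>Z. \<forall>x \<in> Hom C Z T. (\<exists>r \<in> Hom C (Dom C x) S. s1 \<odot> r = a \<odot> x \<and> s2 \<odot> r = b \<odot> x) \<longleftrightarrow>
      (\<exists>y \<in> Hom C Z (Dom C m). m \<odot> y = x)"
    by blast
  moreover have "Cod C m = T" by simp
  ultimately show ?thesis
    unfolding representable_def using pullback_mono[OF Q \<sigma>_mono] by blast
qed

lemma representable_equation:
  assumes a: "a \<in> Hom C T Y" and b: "b \<in> Hom C T Y"
  shows "representable T (\<lambda>x. a \<odot> x = b \<odot> x)"
proof -
  note [simp] = HomD[OF a] HomD[OF b]
  have "representable T (\<lambda>x. \<exists>r \<in> Hom C (Dom C x) Y. Id C Y \<odot> r = a \<odot> x \<and> Id C Y \<odot> r = b \<odot> x)"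
    by (rule representable_relation[OF _ _ _ a b]) (auto simp: jointly_monic_def)
  then show ?thesis
  proof (rule representable_cong[rotated])
    fix x Z assume x: "x \<in> Hom C Z T"
    note [simp] = HomD[OF x]
    show "(\<exists>r \<in> Hom C (Dom C x) Y. Id C Y \<odot> r = a \<odot> x \<and> Id C Y \<odot> r = b \<odot> x) \<longleftrightarrow> a \<odot> x = b \<odot> x"
    proof
      assume "a \<odot> x = b \<odot> x"
      then show "\<exists>r \<in> Hom C (Dom C x) Y. Id C Y \<odot> r = a \<odot> x \<and> Id C Y \<odot> r = b \<odot> x"
        by (intro bexI[of _ "b \<odot> x"]) simp_all
    qed auto
  qed
qed

text \<open>
  The two axes of a product are jointly epic, so an equation between maps on a product only needs
  to be checked when one of the coordinates vanishes.
\<close>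

lemma product_axes_eq:
  assumes P: "is_product C p1 p2 X Y" and g: "g \<in> Hom C (Dom C p1) W" and h: "h \<in> Hom C (Dom C p1) W"
    and 1: "\<And>Z t. t \<in> Hom C Z (Dom C p1) \<Longrightarrow> p2 \<odot> t = zer Z Y \<Longrightarrow> g \<odot> t = h \<odot> t"
    and 2: "\<And>Z t. t \<in> Hom C Z (Dom C p1) \<Longrightarrow> p1 \<odot> t = zer Z X \<Longrightarrow> g \<odot> t = h \<odot> t"
  shows "g = h"
proof -
  note [simp] = productD[OF P] HomD[OF g] HomD[OF h]
  have z: "zer Y X \<in> Hom C Y X" and i: "Id C Y \<in> Hom C Y Y" by simp_all
  note s = tuple_props[OF P z i]
  have "g \<odot> Id C (Dom C p1) = h \<odot> Id C (Dom C p1)"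
    by (rule representable_point[OF representable_equation[OF g h] _ s(1,3) 2[OF s(1,2)] 1]) simp_all
  then show ?thesis by simp
qed

text \<open>
  The Mal'tsev property. For \<open>x S y S z\<close> consider the pairs \<open>(x S y, y S z)\<close>; relatedness of the
  outer terms is obvious for the pairs \<open>(x S x, x S z)\<close>, which form a section, and for the pairs
  \<open>(x S 0, 0 S 0)\<close>, which form the kernel.
\<close>

lemma reflexive_relation_equivalence:
  assumes s: "s1 \<in> Hom C S Y" "s2 \<in> Hom C S Y" "jointly_monic s1 s2"
    and d: "d \<in> Hom C Y S" "s1 \<odot> d = Id C Y" "s2 \<odot> d = Id C Y"
    and \<tau>: "\<tau> \<in> Hom C S S" "s1 \<odot> \<tau> = s2" "s2 \<odot> \<tau> = s1"
  shows "internal_equivalence_relation C s1 s2 Y"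
proof -
  note [simp] = HomD[OF s(1)] HomD[OF s(2)] HomD[OF d(1)]
  obtain p q where P: "is_pullback C p q s2 s1" using pullback_exists[of s2 s1] by auto
  note [simp] = pullbackD[OF P, simplified]
  let ?T = "Dom C p"
  have s1p: "s1 \<odot> p \<in> Hom C ?T Y" and s2q: "s2 \<odot> q \<in> Hom C ?T Y" by simp_all
  obtain t where t: "t \<in> Hom C S ?T" "p \<odot> t = d \<odot> s1" "q \<odot> t = Id C S"
    by (rule pullback_lift[OF P, of "d \<odot> s1" S "Id C S"]) (simp_all add: precomp_eq[OF d(3)])
  note [simp] = HomD[OF t(1)]
  have "\<exists>r \<in> Hom C (Dom C x) S. s1 \<odot> r = (s1 \<odot> p) \<odot> x \<and> s2 \<odot> r = (s2 \<odot> q) \<odot> x"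
    if x: "x \<in> Hom C ?T ?T" for x
  proof (rule representable_point[OF representable_relation[OF s s1p s2q], of q S t])
    show "\<exists>r \<in> Hom C (Dom C t) S. s1 \<odot> r = (s1 \<odot> p) \<odot> t \<and> s2 \<odot> r = (s2 \<odot> q) \<odot> t"
      by (rule bexI[of _ "Id C S"]) (simp_all add: t precomp_eq[OF d(2)])
  next
    fix Z x assume x: "x \<in> Hom C Z ?T" "q \<odot> x = zer Z S"
    note [simp] = HomD[OF x(1)]
    show "\<exists>r \<in> Hom C (Dom C x) S. s1 \<odot> r = (s1 \<odot> p) \<odot> x \<and> s2 \<odot> r = (s2 \<odot> q) \<odot> x"
      by (rule bexI[of _ "p \<odot> x"])
         (use precomp_eq[OF pullback_square(1)[OF P], of x] x(2) in simp_all)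
  qed (use t x in simp_all)
  from this[of "Id C ?T"] have "\<exists>r \<in> Hom C (Dom C p) S. s1 \<odot> r = s1 \<odot> p \<and> s2 \<odot> r = s2 \<odot> q"
    by simp
  then have "\<exists>p q. is_pullback C p q s2 s1 \<and>
      (\<exists>t \<in> Hom C (Dom C p) (Dom C s1). s1 \<odot> t = s1 \<odot> p \<and> s2 \<odot> t = s2 \<odot> q)"
    using P by (intro exI[of _ p] exI[of _ q]) simp
  moreover have "\<exists>d \<in> Hom C Y (Dom C s1). s1 \<odot> d = Id C Y \<and> s2 \<odot> d = Id C Y"
    using d by (intro bexI[of _ d]) simp_all
  moreover have "\<exists>\<tau> \<in> Hom C (Dom C s1) (Dom C s1). s1 \<odot> \<tau> = s2 \<and> s2 \<odot> \<tau> = s1"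
    using \<tau> by (intro bexI[of _ \<tau>]) simp_all
  ultimately show ?thesis
    using s(3) unfolding internal_equivalence_relation_def jointly_monic_def by simp
qed


text \<open>
  The direct image of a reflexive and symmetric relation along a regular epimorphism inherits both
  properties, since its elements lift; transitivity comes for free from the Mal'tsev property. By
  exactness the image is a kernel pair, and the map can be taken to be a regular epimorphism
  because the monic part of its image factorization does not change the kernel pair.
\<close>

lemma direct_image_equivalence:
  assumes f: "f \<in> Hom C X Y" "regular_epi C f"
    and n: "n1 \<in> Hom C N X" "n2 \<in> Hom C N X"
    and d: "d \<in> Hom C X N" "n1 \<odot> d = Id C X" "n2 \<odot> d = Id C X"
    and \<tau>: "\<tau> \<in> Hom C N N" "n1 \<odot> \<tau> = n2" "n2 \<odot> \<tau> = n1"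
  obtains S s1 s2 e \<delta> Q q where "s1 \<in> Hom C S Y" "s2 \<in> Hom C S Y"
    "e \<in> Hom C N S" "regular_epi C e" "s1 \<odot> e = f \<odot> n1" "s2 \<odot> e = f \<odot> n2"
    "\<delta> \<in> Hom C Y S" "s1 \<odot> \<delta> = Id C Y" "s2 \<odot> \<delta> = Id C Y"
    "q \<in> Hom C Y Q" "regular_epi C q" "kernel_pair C s1 s2 q"
proof -
  note [simp] = HomD[OF f(1)] HomD[OF n(1)] HomD[OF n(2)] HomD[OF d(1)] HomD[OF \<tau>(1)]
  obtain p1 p2 where P: "is_product C p1 p2 Y Y" using product_exists[of Y Y] by auto
  note [simp] = productD[OF P]
  define \<nu> where "\<nu> = tuple C p1 p2 (f \<odot> n1) (f \<odot> n2)"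
  have "f \<odot> n1 \<in> Hom C N Y" "f \<odot> n2 \<in> Hom C N Y" by simp_all
  note \<nu> = tuple_props[OF P this, folded \<nu>_def]
  note [simp] = HomD[OF \<nu>(1)]
  obtain S e m where e: "e \<in> Hom C N S" "regular_epi C e" and m: "m \<in> Hom C S (Dom C p1)" "is_mono C m"
    and me: "m \<odot> e = \<nu>" using \<nu>(1) by (rule image_factorization)
  note [simp] = HomD[OF e(1)] HomD[OF m(1)]
  define s1 s2 where "s1 = p1 \<odot> m" and "s2 = p2 \<odot> m"
  have s: "s1 \<in> Hom C S Y" "s2 \<in> Hom C S Y" by (simp_all add: s1_def s2_def)
  note [simp] = HomD[OF s(1)] HomD[OF s(2)]
  have s_mono: "jointly_monic s1 s2"
    unfolding jointly_monic_def
  proof (intro allI ballI impI)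
    fix Z g h assume gh: "g \<in> Hom C Z (Dom C s1)" "h \<in> Hom C Z (Dom C s1)" "s1 \<odot> g = s1 \<odot> h \<and> s2 \<odot> g = s2 \<odot> h"
    note [simp] = HomD[OF gh(1), simplified] HomD[OF gh(2), simplified]
    have "m \<odot> g = m \<odot> h"
      by (rule product_eq[OF P, of _ Z]) (use gh(3) in \<open>simp_all add: s1_def s2_def\<close>)
    from mono_cancel[OF m(2) this, of Z] show "g = h" by simp
  qed
  have se: "s1 \<odot> e = f \<odot> n1" "s2 \<odot> e = f \<odot> n2" by (simp_all add: s1_def s2_def me \<nu>)
  have i: "Id C Y \<in> Hom C Y Y" by simp
  have "\<exists>r \<in> Hom C (Dom C (Id C Y)) S. s1 \<odot> r = Id C Y \<odot> Id C Y \<and> s2 \<odot> r = Id C Y \<odot> Id C Y"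
    by (rule representable_regular_epi[OF representable_relation[OF s s_mono i i] f(2,1) _ i])
       (rule bexI[of _ "e \<odot> d"], simp_all add: precomp_eq[OF se(1)] precomp_eq[OF se(2)] d)
  then obtain \<delta> where \<delta>: "\<delta> \<in> Hom C Y S" "s1 \<odot> \<delta> = Id C Y" "s2 \<odot> \<delta> = Id C Y" by auto
  have j: "Id C S \<in> Hom C S S" by simp
  have "\<exists>r \<in> Hom C (Dom C (Id C S)) S. s1 \<odot> r = s2 \<odot> Id C S \<and> s2 \<odot> r = s1 \<odot> Id C S"
    by (rule representable_regular_epi[OF representable_relation[OF s s_mono s(2,1)] e(2,1) _ j])
       (rule bexI[of _ "e \<odot> \<tau>"], simp_all add: precomp_eq[OF se(1)] precomp_eq[OF se(2)] se \<tau>)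
  then obtain \<sigma> where \<sigma>: "\<sigma> \<in> Hom C S S" "s1 \<odot> \<sigma> = s2" "s2 \<odot> \<sigma> = s1" by auto
  from reflexive_relation_equivalence[OF s s_mono \<delta> \<sigma>] obtain g where K: "kernel_pair C s1 s2 g"
    using semi_abelian unfolding semi_abelian_def barr_exact_def by blast
  then have "g \<in> Hom C Y (Cod C g)" using pullbackD[OF K] by simp
  then obtain Q q l where q: "q \<in> Hom C Y Q" "regular_epi C q" "l \<in> Hom C Q (Cod C g)" "is_mono C l" "l \<odot> q = g"
    by (rule image_factorization)
  have "kernel_pair C s1 s2 q"
    by (rule kernel_pair_cancel_mono[of _ _ l]) (use K q in simp_all)
  then show thesis using that s e se \<delta> q by blast
qed

text \<open>
  In a morphism \<open>(e, f)\<close> of split epimorphisms from \<open>n\<close> to \<open>s\<close> with \<open>e\<close> a regular epimorphism, the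
  comparison \<open>c\<close> to the pullback is one too: \<open>c\<close> covers the domain of \<open>s\<close>, and an element of the
  pullback lying over \<open>0\<close> there comes from the section \<open>d\<close> of \<open>n\<close>. Pulling \<open>c\<close> back along \<open>0\<close>
  shows that the kernel of \<open>n\<close> covers that of \<open>s\<close>.
\<close>

lemma split_epi_comparison_regular:
  assumes f: "f \<in> Hom C X Y" and e: "e \<in> Hom C N S" "regular_epi C e"
    and n: "n \<in> Hom C N X" and s: "s \<in> Hom C S Y"
    and d: "d \<in> Hom C X N" "n \<odot> d = Id C X" and \<delta>: "\<delta> \<in> Hom C Y S" "e \<odot> d = \<delta> \<odot> f"
    and P: "is_pullback C t1 t2 s f" and c: "c \<in> Hom C N (Dom C t1)" "t1 \<odot> c = e" "t2 \<odot> c = n"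
  shows "regular_epi C c"
  unfolding regular_epi_iff_extremal extremal_epi_def
proof (intro conjI allI ballI impI)
  note [simp] = HomD[OF f(1)] HomD[OF e(1)] HomD[OF n] HomD[OF s] HomD[OF d(1)] HomD[OF \<delta>(1)] HomD[OF c(1)]
  note [simp] = pullbackD[OF P, simplified]
  show "c \<in> Arr C" by simp
  fix m h assume h: "h \<in> Hom C (Dom C c) (Dom C m)" and m: "is_mono C m \<and> Cod C m = Cod C c \<and> m \<odot> h = c"
  let ?T = "Dom C t1"
  have [simp]: "m \<in> Arr C" "Cod C m = ?T" using m by (simp_all add: is_mono_def)
  note [simp] = HomD[OF h, simplified]
  have t1: "t1 \<in> Hom C ?T S" by simp
  have t1c: "regular_epi C (t1 \<odot> c)" using e c by simp
  have "\<exists>y \<in> Hom C (Dom C (Id C ?T)) (Dom C m). m \<odot> y = Id C ?T"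
  proof (rule representable_extension[OF representable_factor t1 c(1) _ t1c])
    show "\<exists>y \<in> Hom C (Dom C c) (Dom C m). m \<odot> y = c" using m by (intro bexI[of _ h]) simp_all
  next
    fix Z x assume x: "x \<in> Hom C Z ?T" "t1 \<odot> x = zer Z S"
    note [simp] = HomD[OF x(1)]
    have "f \<odot> (t2 \<odot> x) = s \<odot> (t1 \<odot> x)"
      using precomp_eq[OF pullback_square(1)[OF P], of x] by simp
    then have ft2: "f \<odot> (t2 \<odot> x) = zer Z Y" by (simp add: x(2))
    have edt2: "e \<odot> (d \<odot> (t2 \<odot> x)) = zer Z S"
      using precomp_eq[OF \<delta>(2), of "t2 \<odot> x"] ft2 by simp
    have "c \<odot> (d \<odot> (t2 \<odot> x)) = x"
      by (rule pullback_eq[OF P, of _ Z])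
         (simp_all add: edt2 precomp_eq[OF c(2)] precomp_eq[OF c(3)] x(2) precomp_eq[OF d(2)])
    moreover have "m \<odot> (h \<odot> (d \<odot> (t2 \<odot> x))) = c \<odot> (d \<odot> (t2 \<odot> x))"
      by (rule precomp_eq) (use m in simp_all)
    ultimately show "\<exists>y \<in> Hom C (Dom C x) (Dom C m). m \<odot> y = x"
      by (intro bexI[of _ "h \<odot> (d \<odot> (t2 \<odot> x))"]) simp_all
  qed (use m in simp_all)
  then obtain y where "y \<in> Hom C (Cod C m) (Dom C m)" "m \<odot> y = Id C (Cod C m)" by auto
  with m show "is_iso C m" by (intro mono_split_iso[of m y]) simp_all
qed

text \<open>
  A binary operation \<open>\<delta>\<close> satisfying \<open>\<delta>(0, y) = y\<close> and \<open>\<delta>(x, x) = 0\<close> is \<open>y - x\<close> for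
  an abelian group structure, with addition \<open>\<delta>(\<delta>(x, 0), y)\<close>. On the axes of a product both sides
  of the identity \<open>\<delta>(\<delta>(x, 0), \<delta>(x, y)) = y\<close> agree; its case \<open>y = x\<close> says that \<open>x \<mapsto> \<delta>(x, 0)\<close> is an
  involution, from which the unit and inverse laws follow. Commutativity and associativity can then
  be read off on the axes.
\<close>

lemma subtraction_abelian:
  assumes P: "is_product C p1 p2 X X" and \<delta>: "\<delta> \<in> Hom C (Dom C p1) X"
    and zero_left: "\<And>Z y. y \<in> Hom C Z X \<Longrightarrow> \<delta> \<odot> tuple C p1 p2 (zer Z X) y = y"
    and self: "\<And>Z x. x \<in> Hom C Z X \<Longrightarrow> \<delta> \<odot> tuple C p1 p2 x x = zer Z X"
  shows "X \<in> abelian_objects C"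
proof -
  note [simp] = productD[OF P] HomD[OF \<delta>]
  let ?P = "Dom C p1"
  define sub where "sub x y = \<delta> \<odot> tuple C p1 p2 x y" for x y
  have sub_simps [simp]: "sub x y \<in> Arr C" "Dom C (sub x y) = Dom C x" "Cod C (sub x y) = X"
    if "x \<in> Arr C" "y \<in> Arr C" "Cod C x = X" "Cod C y = X" "Dom C y = Dom C x" for x y
  proof -
    have "x \<in> Hom C (Dom C x) X" "y \<in> Hom C (Dom C x) X" using that by simp_all
    note [simp] = HomD[OF tuple_props(1)[OF P this]]
    show "sub x y \<in> Arr C" "Dom C (sub x y) = Dom C x" "Cod C (sub x y) = X"
      by (simp_all add: sub_def)
  qed
  have sub_comp [simp]: "sub x y \<odot> z = sub (x \<odot> z) (y \<odot> z)"
    if "x \<in> Arr C" "y \<in> Arr C" "Cod C x = X" "Cod C y = X" "Dom C y = Dom C x"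
      "z \<in> Arr C" "Cod C z = Dom C x" for x y z
  proof -
    have xyz: "x \<in> Hom C (Dom C x) X" "y \<in> Hom C (Dom C x) X" "z \<in> Hom C (Dom C z) (Dom C x)"
      using that by simp_all
    note [simp] = HomD[OF tuple_props(1)[OF P xyz(1,2)]]
    show ?thesis using that tuple_comp[OF P xyz] by (simp add: sub_def)
  qed
  have sub_zero [simp]: "sub (zer Z X) y = y" if "y \<in> Arr C" "Cod C y = X" "Dom C y = Z" for y Z
    using zero_left[of y Z] that by (simp add: sub_def)
  have sub_self [simp]: "sub x x = zer (Dom C x) X" if "x \<in> Arr C" "Cod C x = X" for x
    using self[of x "Dom C x"] that by (simp add: sub_def)
  have minus: "sub (sub p1 (zer ?P X)) (sub p1 p2) = p2"
    by (rule product_axes_eq[OF P, of _ X]) simp_all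
  have minus_minus [simp]: "sub (sub x (zer Z X)) (zer Z X) = x"
    if "x \<in> Arr C" "Cod C x = X" "Dom C x = Z" for x Z
  proof -
    have x: "x \<in> Hom C Z X" using that by simp
    note t = tuple_props[OF P x x]
    note [simp] = HomD[OF t(1)]
    have "sub (sub p1 (zer ?P X)) (sub p1 p2) \<odot> tuple C p1 p2 x x = p2 \<odot> tuple C p1 p2 x x"
      by (simp only: minus)
    then show ?thesis using that by (simp add: t)
  qed
  define m where "m = sub (sub p1 (zer ?P X)) p2"
  have m: "m \<in> Hom C ?P X" by (simp add: m_def)
  have m_tuple: "m \<odot> tuple C p1 p2 x y = sub (sub x (zer Z X)) y"
    if x: "x \<in> Hom C Z X" and y: "y \<in> Hom C Z X" for x y Z
  proof -
    note t = tuple_props[OF P x y]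
    note [simp] = HomD[OF t(1)] HomD[OF x] HomD[OF y]
    show ?thesis by (simp add: m_def t)
  qed
  obtain a c where Q: "is_product C a c ?P X" using product_exists[of ?P X] by auto
  note [simp] = productD[OF Q]
  let ?Q = "Dom C a"
  define i where "i = sub (Id C X) (zer X X)"
  have i: "i \<in> Hom C X X" by (simp add: i_def)
  have [simp]: "m \<odot> a = sub (sub (p1 \<odot> a) (zer ?Q X)) (p2 \<odot> a)" by (simp add: m_def)
  have [simp]: "a \<odot> t \<in> Arr C" if "t \<in> Arr C" "Cod C t = ?Q" for t using that by simp
  have comm: "m \<odot> tuple C p1 p2 p2 p1 = m"
  proof -
    have "m \<odot> tuple C p1 p2 p2 p1 = sub (sub p2 (zer ?P X)) p1"
      by (rule m_tuple) simp_all
    also have "\<dots> = m"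
      unfolding m_def by (rule product_axes_eq[OF P, of _ X]) simp_all
    finally show ?thesis .
  qed
  have assoc: "m \<odot> tuple C p1 p2 (m \<odot> a) c =
      m \<odot> tuple C p1 p2 (p1 \<odot> a) (m \<odot> tuple C p1 p2 (p2 \<odot> a) c)"
  proof -
    have 1: "m \<odot> tuple C p1 p2 (m \<odot> a) c = sub (sub (m \<odot> a) (zer ?Q X)) c"
      by (rule m_tuple) simp_all
    have 2: "m \<odot> tuple C p1 p2 (p2 \<odot> a) c = sub (sub (p2 \<odot> a) (zer ?Q X)) c"
      by (rule m_tuple) simp_all
    have 3: "m \<odot> tuple C p1 p2 (p1 \<odot> a) (m \<odot> tuple C p1 p2 (p2 \<odot> a) c) =
        sub (sub (p1 \<odot> a) (zer ?Q X)) (sub (sub (p2 \<odot> a) (zer ?Q X)) c)"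
      unfolding 2 by (rule m_tuple) simp_all
    have "sub (sub (m \<odot> a) (zer ?Q X)) c =
        sub (sub (p1 \<odot> a) (zer ?Q X)) (sub (sub (p2 \<odot> a) (zer ?Q X)) c)"
      by (rule product_axes_eq[OF Q, of _ X]) simp_all
    then show ?thesis by (simp only: 1 3)
  qed
  have I: "Id C X \<in> Hom C X X" and Z: "zer X X \<in> Hom C X X" by simp_all
  have units: "m \<odot> tuple C p1 p2 (Id C X) (zer X X) = Id C X" "m \<odot> tuple C p1 p2 (zer X X) (Id C X) = Id C X"
    by (simp_all add: m_tuple[OF I Z] m_tuple[OF Z I])
  have inverses: "m \<odot> tuple C p1 p2 (Id C X) i = zer X X" "m \<odot> tuple C p1 p2 i (Id C X) = zer X X"
    by (simp_all add: m_tuple[OF I i] m_tuple[OF i I]) (simp_all add: i_def)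
  have "terminal_object C zob" using zero_object_zob unfolding zero_object_def by simp
  then have "internal_abelian_group C X p1 p2 a c zob m (zer zob X) i"
    unfolding internal_abelian_group_def
    using P Q m i comm assoc units inverses by simp
  then show ?thesis unfolding abelian_objects_def by blast
qed

end

section \<open>Elements annihilated by a reflector\<close>

locale reflective_subcat = semi_abelian_cat C for C :: "('o, 'm) cat" (structure) +
  fixes B :: "'o set" and b :: "('o, 'm) reflector"
  assumes reflector: "is_reflector C B b"
begin

lemma refl_obj_mem: "X \<in> Obj C \<Longrightarrow> refl_obj b X \<in> B"
  using reflector unfolding is_reflector_def is_functor_def by (simp add: full_subcat_def)

lemma refl_unit_simps [simp]:
  assumes "X \<in> Obj C"
  shows "refl_unit b X \<in> Arr C" "Dom C (refl_unit b X) = X" "Cod C (refl_unit b X) = refl_obj b X"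
    "refl_obj b X \<in> Obj C"
proof -
  have "refl_unit b X \<in> Hom C X (refl_obj b X)"
    using reflector assms unfolding is_reflector_def by blast
  from HomD[OF this] show "refl_unit b X \<in> Arr C" "Dom C (refl_unit b X) = X"
    "Cod C (refl_unit b X) = refl_obj b X" "refl_obj b X \<in> Obj C" by simp_all
qed

lemma refl_arr_simps [simp]:
  assumes "f \<in> Arr C"
  shows "refl_arr b f \<in> Arr C" "Dom C (refl_arr b f) = refl_obj b (Dom C f)"
    "Cod C (refl_arr b f) = refl_obj b (Cod C f)"
  using reflector assms unfolding is_reflector_def is_functor_def by (simp_all add: full_subcat_def Hom_def)

lemma unit_natural: "f \<in> Arr C \<Longrightarrow> refl_arr b f \<odot> refl_unit b (Dom C f) = refl_unit b (Cod C f) \<odot> f"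
  using reflector unfolding is_reflector_def by blast

lemma unit_factor:
  assumes "f \<in> Hom C X Y" "Y \<in> B"
  obtains g where "g \<in> Hom C (refl_obj b X) Y" "g \<odot> refl_unit b X = f"
  using reflector assms HomD(4)[OF assms(1)] unfolding is_reflector_def by blast

lemma unit_eq:
  assumes "X \<in> Obj C" "Y \<in> B" "g \<in> Hom C (refl_obj b X) Y" "h \<in> Hom C (refl_obj b X) Y"
    "g \<odot> refl_unit b X = h \<odot> refl_unit b X"
  shows "g = h"
proof -
  have "h \<odot> refl_unit b X \<in> Hom C X Y" using assms(1,3,4) by simp
  then have "\<exists>!k. k \<in> Hom C (refl_obj b X) Y \<and> k \<odot> refl_unit b X = h \<odot> refl_unit b X"
    using reflector assms(1,2) unfolding is_reflector_def by blast
  then show ?thesis by (rule Ex1_at_most_one) (use assms in simp_all)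
qed

text \<open>
  The generalized elements of the kernel of the unit. This kernel is the relative commutator
  \<open>[X]\<close>, functorial in \<open>X\<close>; speaking of its elements avoids choosing it.
\<close>

definition null :: "'m \<Rightarrow> bool" where
  "null x \<longleftrightarrow> x \<in> Arr C \<and> refl_unit b (Cod C x) \<odot> x = zer (Dom C x) (refl_obj b (Cod C x))"

lemma null_to_subcat:
  assumes "null x" "g \<in> Hom C (Cod C x) Y" "Y \<in> B"
  shows "g \<odot> x = zer (Dom C x) Y"
proof -
  have [simp]: "x \<in> Arr C" and x: "refl_unit b (Cod C x) \<odot> x = zer (Dom C x) (refl_obj b (Cod C x))"
    using assms(1) unfolding null_def by simp_all
  obtain h where h: "h \<in> Hom C (refl_obj b (Cod C x)) Y" "h \<odot> refl_unit b (Cod C x) = g"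
    using unit_factor assms(2,3) by blast
  note [simp] = HomD[OF h(1)]
  have "h \<odot> (refl_unit b (Cod C x) \<odot> x) = g \<odot> x" by (simp add: precomp_eq[OF h(2)])
  with x show ?thesis by simp
qed

lemma null_image:
  assumes "null x" "f \<in> Hom C (Cod C x) Y"
  shows "null (f \<odot> x)"
proof -
  note [simp] = HomD[OF assms(2)]
  have [simp]: "x \<in> Arr C" using assms(1) unfolding null_def by simp
  have "refl_unit b Y \<odot> f \<in> Hom C (Cod C x) (refl_obj b Y)" by simp
  from null_to_subcat[OF assms(1) this refl_obj_mem] show ?thesis unfolding null_def by simp
qed

lemma perfect_iff_null_id: "perfect C b U \<longleftrightarrow> U \<in> Obj C \<and> null (Id C U)"
proof
  assume U: "perfect C b U"
  then have [simp]: "U \<in> Obj C" and Z: "zero_object C (refl_obj b U)" unfolding perfect_def by simp_all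
  from Z have "refl_unit b U = zer U (refl_obj b U)"
    unfolding zero_object_def terminal_object_def
    by (metis Hom_iff \<open>U \<in> Obj C\<close> refl_unit_simps(1-4) zer_simps)
  then show "U \<in> Obj C \<and> null (Id C U)" unfolding null_def by simp
next
  assume U: "U \<in> Obj C \<and> null (Id C U)"
  let ?V = "refl_obj b U"
  have [simp]: "U \<in> Obj C" using U by simp
  have "refl_unit b U = zer U ?V" using U unfolding null_def by simp
  then have "Id C ?V \<odot> refl_unit b U = zer ?V ?V \<odot> refl_unit b U" by simp
  from unit_eq[OF _ refl_obj_mem _ _ this] have eq: "Id C ?V = zer ?V ?V" by simp
  have *: "f = zer X ?V" if "f \<in> Hom C X ?V" for f X
    using that id_comp[of f ?V] zer_comp[of f ?V ?V] eq by simp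
  have **: "f = zer ?V X" if "f \<in> Hom C ?V X" for f X
    using that comp_id[of f ?V] comp_zer[of f ?V ?V] eq by simp
  have to_V: "\<exists>!f. f \<in> Hom C X ?V" if "X \<in> Obj C" for X
    by (rule ex1I[OF _ *[of _ X]]) (use that in simp_all)
  have from_V: "\<exists>!f. f \<in> Hom C ?V X" if "X \<in> Obj C" for X
    by (rule ex1I[OF _ **[of _ X]]) (use that in simp_all)
  have "?V \<in> Obj C" by simp
  then have "zero_object C ?V"
    unfolding zero_object_def initial_object_def terminal_object_def
    by (intro conjI ballI to_V from_V)
  then show "perfect C b U" unfolding perfect_def by simp
qed

text \<open>
  For groups and abelianization, \<open>h2 z = h1 z k(z)\<close> with \<open>k(z)\<close> in the kernel of \<open>f\<close>; if the kernel is
  central then \<open>k\<close> is a homomorphism to an abelian group, so it vanishes on commutators. The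
  condition below is this property of central extensions for an arbitrary reflector.
\<close>

definition null_central :: "'m \<Rightarrow> bool" where
  "null_central f \<longleftrightarrow> regular_epi C f \<and>
    (\<forall>Z W. \<forall>h1 \<in> Hom C Z (Dom C f). \<forall>h2 \<in> Hom C Z (Dom C f). \<forall>x \<in> Hom C W Z.
      f \<odot> h1 = f \<odot> h2 \<and> null x \<longrightarrow> h1 \<odot> x = h2 \<odot> x)"

lemma null_centralD:
  assumes "null_central f" "h1 \<in> Hom C Z (Dom C f)" "h2 \<in> Hom C Z (Dom C f)" "f \<odot> h1 = f \<odot> h2"
    "x \<in> Hom C W Z" "null x"
  shows "h1 \<odot> x = h2 \<odot> x"
  using assms unfolding null_central_def by blast

lemma perfect_maps_eq:
  assumes f: "null_central f" and U: "perfect C b U"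
    and h: "h1 \<in> Hom C U (Dom C f)" "h2 \<in> Hom C U (Dom C f)" "f \<odot> h1 = f \<odot> h2"
  shows "h1 = h2"
proof -
  note [simp] = HomD[OF h(1)] HomD[OF h(2)]
  show ?thesis
    using null_centralD[OF f h, of "Id C U" U] U unfolding perfect_iff_null_id by simp
qed

lemma null_central_comp_mono:
  assumes f: "null_central f" and m: "is_mono C m" "m \<in> Hom C M (Dom C f)" and fm: "regular_epi C (f \<odot> m)"
  shows "null_central (f \<odot> m)"
  unfolding null_central_def
proof (intro conjI allI ballI impI)
  have [simp]: "f \<in> Arr C" using f unfolding null_central_def by simp
  note [simp] = HomD[OF m(2)]
  fix Z W h1 h2 x assume h1: "h1 \<in> Hom C Z (Dom C (f \<odot> m))" and h2: "h2 \<in> Hom C Z (Dom C (f \<odot> m))"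
    and x: "x \<in> Hom C W Z" and *: "(f \<odot> m) \<odot> h1 = (f \<odot> m) \<odot> h2 \<and> null x"
  note [simp] = HomD[OF h1, simplified] HomD[OF h2, simplified] HomD[OF x]
  have "m \<odot> (h1 \<odot> x) = m \<odot> (h2 \<odot> x)"
    using null_centralD[OF f, of "m \<odot> h1" Z "m \<odot> h2" x W] * by simp
  from mono_cancel[OF m(1) this, of W] show "h1 \<odot> x = h2 \<odot> x" by simp
qed (rule fm)

lemma null_central_pullback:
  assumes f: "null_central f" and P: "is_pullback C p q g f"
  shows "null_central p"
  unfolding null_central_def
proof (intro conjI allI ballI impI)
  note [simp] = pullbackD[OF P] pullback_square(2)[OF P]
  show "regular_epi C p" using f regular_epi_pullback[OF P] unfolding null_central_def by simp
  fix Z W h1 h2 x assume h1: "h1 \<in> Hom C Z (Dom C p)" and h2: "h2 \<in> Hom C Z (Dom C p)"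
    and x: "x \<in> Hom C W Z" and *: "p \<odot> h1 = p \<odot> h2 \<and> null x"
  note [simp] = HomD[OF h1] HomD[OF h2] HomD[OF x]
  have "f \<odot> (q \<odot> h1) = f \<odot> (q \<odot> h2)"
    using * precomp_eq[OF pullback_square(1)[OF P], of h1] precomp_eq[OF pullback_square(1)[OF P], of h2]
    by simp
  from null_centralD[OF f _ _ this, of Z x W] have "q \<odot> (h1 \<odot> x) = q \<odot> (h2 \<odot> x)" using * by simp
  moreover have "p \<odot> (h1 \<odot> x) = p \<odot> (h2 \<odot> x)"
    using * precomp_eq[of p h1 "p \<odot> h2" x] by simp
  ultimately show "h1 \<odot> x = h2 \<odot> x"
    using pullback_eq[OF P, of "h1 \<odot> x" W "h2 \<odot> x"] by simp
qed

lemma trivial_extension_eq: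
  assumes p: "trivial_extension C b p" and x: "x \<in> Hom C Z (Dom C p)" and y: "y \<in> Hom C Z (Dom C p)"
    and "refl_unit b (Dom C p) \<odot> x = refl_unit b (Dom C p) \<odot> y" "p \<odot> x = p \<odot> y"
  shows "x = y"
proof -
  have "is_pullback C (refl_unit b (Dom C p)) p (refl_arr b p) (refl_unit b (Cod C p))" "p \<in> Arr C"
    using p unfolding trivial_extension_def by simp_all
  then show ?thesis using assms pullback_eq[of _ p _ _ x Z y] by simp
qed

end

section \<open>Central extensions relative to a Birkhoff subcategory\<close>

locale birkhoff_reflection = reflective_subcat C B b
  for C :: "('o, 'm) cat" (structure) and B :: "'o set" and b :: "('o, 'm) reflector" +
  assumes birkhoff: "birkhoff_subcategory C B"
begin

lemma quotient_mem: "regular_epi C q \<Longrightarrow> Dom C q \<in> B \<Longrightarrow> Cod C q \<in> B"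
  using birkhoff unfolding birkhoff_subcategory_def by blast

lemma unit_regular_epi:
  assumes [simp]: "X \<in> Obj C"
  shows "regular_epi C (refl_unit b X)"
proof -
  have "refl_unit b X \<in> Hom C X (refl_obj b X)" by simp
  then obtain I e m where e: "e \<in> Hom C X I" "regular_epi C e" and m: "m \<in> Hom C I (refl_obj b X)" "is_mono C m"
    and me: "m \<odot> e = refl_unit b X" by (rule image_factorization)
  note [simp] = HomD[OF e(1)] HomD[OF m(1)]
  have "I \<in> B"
    using birkhoff m refl_obj_mem[of X] unfolding birkhoff_subcategory_def by auto
  then obtain g where g: "g \<in> Hom C (refl_obj b X) I" "g \<odot> refl_unit b X = e"
    using unit_factor e(1) by blast
  note [simp] = HomD[OF g(1)]
  have "(m \<odot> g) \<odot> refl_unit b X = Id C (refl_obj b X) \<odot> refl_unit b X"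
    by (simp add: g(2) me)
  from unit_eq[OF _ refl_obj_mem _ _ this] have "m \<odot> g = Id C (refl_obj b X)" by simp
  then have "is_iso C m" using m(2) by (intro mono_split_iso[of m g]) simp_all
  then show ?thesis using regular_epi_iso[OF e(2), of m] me by simp
qed

text \<open>
  Regular epimorphisms induce regular epimorphisms between the kernels of the units. The direct
  image along \<open>f\<close> of the kernel pair of \<open>\<eta>\<^sub>X\<close> is, by exactness, the kernel pair of some \<open>q\<close>. The
  codomain of \<open>q\<close> is a quotient of \<open>b X\<close>, hence lies in \<open>B\<close>, so that \<open>q\<close> sends the given null
  element to \<open>0\<close>: this element is then related to \<open>0\<close> by the image relation, and the comparison
  of split epimorphisms provides a preimage related to \<open>0\<close>.
\<close>

lemma null_lift:
  assumes f: "f \<in> Hom C X Y" "regular_epi C f" and y: "y \<in> Hom C W Y" "null y"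
  obtains V c x where "c \<in> Hom C V W" "regular_epi C c" "x \<in> Hom C V X" "null x" "f \<odot> x = y \<odot> c"
proof -
  note [simp] = HomD[OF f(1)] HomD[OF y(1)]
  let ?\<eta> = "refl_unit b X"
  obtain n1 n2 where N: "kernel_pair C n1 n2 ?\<eta>" using pullback_exists[of ?\<eta> ?\<eta>] by auto
  note [simp] = pullbackD[OF N, simplified]
  let ?N = "Dom C n1"
  obtain d where d: "d \<in> Hom C X ?N" "n1 \<odot> d = Id C X" "n2 \<odot> d = Id C X"
    by (rule pullback_lift[OF N, of "Id C X" X "Id C X"]) simp_all
  obtain \<tau> where \<tau>: "\<tau> \<in> Hom C ?N ?N" "n1 \<odot> \<tau> = n2" "n2 \<odot> \<tau> = n1"
    by (rule pullback_lift[OF N, of n2 ?N n1]) (simp_all add: pullback_square(1)[OF N])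
  have n: "n1 \<in> Hom C ?N X" "n2 \<in> Hom C ?N X" by simp_all
  obtain S s1 s2 e \<delta> Q q where s: "s1 \<in> Hom C S Y" "s2 \<in> Hom C S Y"
    and e: "e \<in> Hom C ?N S" "regular_epi C e" and se: "s1 \<odot> e = f \<odot> n1" "s2 \<odot> e = f \<odot> n2"
    and \<delta>: "\<delta> \<in> Hom C Y S" "s1 \<odot> \<delta> = Id C Y" "s2 \<odot> \<delta> = Id C Y"
    and q: "q \<in> Hom C Y Q" "regular_epi C q" and K: "kernel_pair C s1 s2 q"
    by (rule direct_image_equivalence[OF f n d \<tau>])
  note [simp] = HomD[OF d(1)] HomD[OF s(1)] HomD[OF s(2)] HomD[OF e(1)] HomD[OF \<delta>(1)] HomD[OF q(1)]
  have "q \<odot> (s1 \<odot> e) = q \<odot> (s2 \<odot> e)"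
    using precomp_eq[OF pullback_square(1)[OF K], of e] by simp
  then have qn: "(q \<odot> f) \<odot> n1 = (q \<odot> f) \<odot> n2" by (simp add: se)
  obtain t where t: "t \<in> Hom C (refl_obj b X) Q" "t \<odot> ?\<eta> = q \<odot> f"
    by (rule regular_epi_factor[OF unit_regular_epi N _ qn, of Q]) simp_all
  note [simp] = HomD[OF t(1)]
  have "regular_epi C (t \<odot> ?\<eta>)" unfolding t(2) by (rule regular_epi_comp[OF f(2) q(2)]) simp
  then have "regular_epi C t" by (rule regular_epi_cancel_left) simp_all
  then have "Q \<in> B" using quotient_mem[of t] refl_obj_mem[of X] by simp
  with null_to_subcat[OF y(2), of q Q] have qy: "q \<odot> y = zer W Q" by simp
  obtain w where w: "w \<in> Hom C W S" "s1 \<odot> w = y" "s2 \<odot> w = zer W Y"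
    by (rule pullback_lift[OF K, of y W "zer W Y"]) (simp_all add: qy)
  note [simp] = HomD[OF w(1)]
  obtain t1 t2 where P: "is_pullback C t1 t2 s2 f" using pullback_exists[of s2 f] by auto
  note [simp] = pullbackD[OF P, simplified]
  obtain c where c: "c \<in> Hom C ?N (Dom C t1)" "t1 \<odot> c = e" "t2 \<odot> c = n2"
    by (rule pullback_lift[OF P, of e ?N n2]) (simp_all add: se)
  note [simp] = HomD[OF c(1)]
  have ed: "e \<odot> d = \<delta> \<odot> f"
    by (rule pullback_eq[OF K, of _ X])
       (simp_all add: precomp_eq[OF se(1)] precomp_eq[OF se(2)] d precomp_eq[OF \<delta>(2)] precomp_eq[OF \<delta>(3)])
  have c_epi: "regular_epi C c"
    by (rule split_epi_comparison_regular[OF f(1) e n(2) s(2) d(1,3) \<delta>(1) ed P c])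
  \<comment> \<open>The pair (\<open>y\<close> related to \<open>0\<close>, \<open>0\<close>) as an element of the pullback; a lift \<open>z\<close> along \<open>c\<close> is then a
      pair (\<open>n1 z\<close>, \<open>0\<close>) in the kernel pair of the unit.\<close>
  obtain u where u: "u \<in> Hom C W (Dom C t1)" "t1 \<odot> u = w" "t2 \<odot> u = zer W X"
    by (rule pullback_lift[OF P, of w W "zer W X"]) (simp_all add: w(3))
  note [simp] = HomD[OF u(1)]
  have "u \<in> Hom C W (Cod C c)" by simp
  from regular_epi_lift[OF c_epi this] obtain V v z where
    v: "v \<in> Hom C V W" "regular_epi C v" and z: "z \<in> Hom C V (Dom C c)" "c \<odot> z = u \<odot> v" by blast
  note [simp] = HomD[OF v(1)] HomD[OF z(1), simplified]
  have "n2 \<odot> z = t2 \<odot> (c \<odot> z)" by (simp add: precomp_eq[OF c(3)])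
  also have "\<dots> = zer V X" by (simp add: z(2) precomp_eq[OF u(3)])
  finally have n2z: "n2 \<odot> z = zer V X" .
  have "null (n1 \<odot> z)"
    unfolding null_def using precomp_eq[OF pullback_square(1)[OF N], of z] n2z by simp
  moreover have "f \<odot> (n1 \<odot> z) = y \<odot> v"
  proof -
    have "f \<odot> (n1 \<odot> z) = s1 \<odot> (e \<odot> z)" by (simp add: precomp_eq[OF se(1)])
    also have "\<dots> = s1 \<odot> (t1 \<odot> (c \<odot> z))" by (simp add: precomp_eq[OF c(2)])
    also have "\<dots> = y \<odot> v" by (simp add: z(2) precomp_eq[OF u(2)] precomp_eq[OF w(2)])
    finally show ?thesis .
  qed
  moreover have "n1 \<odot> z \<in> Hom C V X" by simp
  ultimately show thesis using that v by blast
qed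

text \<open>
  Let the pullback \<open>p\<close> of \<open>f\<close> along \<open>g\<close> be trivial. Two maps with the same composite with \<open>f\<close> lift,
  after a change of stage, to maps into the domain of \<open>p\<close> with the same composite with \<open>p\<close>. They
  agree on null elements because \<open>p\<close> and the unit are jointly monic; and null elements survive the
  change of stage by the preceding lemma. A smaller reflective subcategory \<open>D\<close> has more null
  elements, so triviality relative to \<open>D\<close> suffices.
\<close>

lemma central_imp_null_central:
  assumes a: "is_reflector C D a" and DB: "D \<subseteq> B" and f: "central_extension C a f"
  shows "null_central f"
  unfolding null_central_def
proof (intro conjI allI ballI impI)
  interpret a: reflective_subcat C D a using a by unfold_locales
  show "regular_epi C f" using f unfolding central_extension_def by simp
  then have [simp]: "f \<in> Arr C" by simp
  obtain g p q where g: "regular_epi C g" and P: "is_pullback C p q g f" and p: "trivial_extension C a p"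
    using f unfolding central_extension_def by blast
  note [simp] = pullbackD[OF P] pullback_square(2)[OF P]
  fix Z W h1 h2 x assume h1: "h1 \<in> Hom C Z (Dom C f)" and h2: "h2 \<in> Hom C Z (Dom C f)"
    and x: "x \<in> Hom C W Z" and *: "f \<odot> h1 = f \<odot> h2 \<and> null x"
  note [simp] = HomD[OF h1] HomD[OF h2] HomD[OF x]
  have "f \<odot> h1 \<in> Hom C Z (Cod C g)" by simp
  from regular_epi_lift[OF g this] obtain V c z where
    c: "c \<in> Hom C V Z" "regular_epi C c" and z: "z \<in> Hom C V (Dom C g)" "g \<odot> z = (f \<odot> h1) \<odot> c" by blast
  note [simp] = HomD[OF c(1)] HomD[OF z(1)]
  obtain k1 where k1: "k1 \<in> Hom C V (Dom C p)" "p \<odot> k1 = z" "q \<odot> k1 = h1 \<odot> c"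
    by (rule pullback_lift[OF P, of z V "h1 \<odot> c"]) (simp_all add: z(2))
  have fh2: "f \<odot> (h2 \<odot> c) = g \<odot> z" using precomp_eq[OF conjunct1[OF *], of c] by (simp add: z(2))
  obtain k2 where k2: "k2 \<in> Hom C V (Dom C p)" "p \<odot> k2 = z" "q \<odot> k2 = h2 \<odot> c"
    by (rule pullback_lift[OF P, of z V "h2 \<odot> c"]) (simp_all add: fh2)
  note [simp] = HomD[OF k1(1)] HomD[OF k2(1)]
  obtain V' c' x' where
    c': "c' \<in> Hom C V' W" "regular_epi C c'" and x': "x' \<in> Hom C V' V" "null x'" "c \<odot> x' = x \<odot> c'"
    by (rule null_lift[OF c x conjunct2[OF *]])
  note [simp] = HomD[OF c'(1)] HomD[OF x'(1)]
  have a0: "refl_unit a (Dom C p) \<odot> (k \<odot> x') = zer V' (refl_obj a (Dom C p))"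
    if k: "k \<in> Hom C V (Dom C p)" for k
  proof -
    note [simp] = HomD[OF k]
    have "null (k \<odot> x')" using null_image[OF x'(2), of k] by simp
    from null_to_subcat[OF this, of "refl_unit a (Dom C p)" "refl_obj a (Dom C p)"] show ?thesis
      using DB a.refl_obj_mem[of "Dom C p"] by auto
  qed
  have "k1 \<odot> x' = k2 \<odot> x'"
    by (rule a.trivial_extension_eq[OF p, of _ V'])
       (simp_all add: a0 precomp_eq[OF k1(2)] precomp_eq[OF k2(2)])
  then have "q \<odot> (k1 \<odot> x') = q \<odot> (k2 \<odot> x')" by simp
  then have "(h1 \<odot> x) \<odot> c' = (h2 \<odot> x) \<odot> c'"
    by (simp add: precomp_eq[OF k1(3)] precomp_eq[OF k2(3)] x'(3))
  from regular_epi_cancel_right[OF c'(2) _ _ this, of "Dom C f"] show "h1 \<odot> x = h2 \<odot> x" by simp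
qed

text \<open>
  Both projections of the kernel pair \<open>R\<close> agree on null elements. So the null elements of \<open>R\<close> are
  the null elements of the diagonal, and the comparison from \<open>R\<close> to the pullback of the
  naturality square is an isomorphism by the Short Five Lemma over \<open>b R\<close>.
\<close>

lemma null_central_kernel_pair_trivial:
  assumes f: "null_central f" and R: "kernel_pair C p1 p2 f"
  shows "trivial_extension C b p1"
proof -
  note [simp] = pullbackD[OF R]
  let ?R = "Dom C p1" let ?X = "Dom C f" let ?\<eta>R = "refl_unit b ?R" let ?\<eta>X = "refl_unit b ?X"
  have p1_epi: "regular_epi C p1"
    using f regular_epi_pullback[OF R] unfolding null_central_def by blast
  have nat: "refl_arr b p1 \<odot> ?\<eta>R = ?\<eta>X \<odot> p1" using unit_natural[of p1] by simp
  obtain \<pi>1 \<pi>2 where Q: "is_pullback C \<pi>1 \<pi>2 (refl_arr b p1) ?\<eta>X"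
    using pullback_exists[of "refl_arr b p1" ?\<eta>X] by auto
  note [simp] = pullbackD[OF Q, simplified]
  let ?Q = "Dom C \<pi>1"
  have \<pi>1_epi: "regular_epi C \<pi>1" by (rule regular_epi_pullback[OF Q unit_regular_epi]) simp
  obtain c where c: "c \<in> Hom C ?R ?Q" "\<pi>1 \<odot> c = ?\<eta>R" "\<pi>2 \<odot> c = p1"
    by (rule pullback_lift[OF Q, of ?\<eta>R ?R p1]) (simp_all add: nat)
  note [simp] = HomD[OF c(1)]
  obtain k K where k: "is_kernel C k ?\<eta>R" "k \<in> Hom C K ?R"
    using kernel_exists[of ?\<eta>R ?R "refl_obj b ?R"] by auto
  obtain k' K' where k': "is_kernel C k' \<pi>1" "k' \<in> Hom C K' ?Q"
    using kernel_exists[of \<pi>1 ?Q "refl_obj b ?R"] by auto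
  note [simp] = HomD[OF k(2)] HomD[OF k'(2)]
  have k0: "?\<eta>R \<odot> k = zer K (refl_obj b ?R)" "\<pi>1 \<odot> k' = zer K' (refl_obj b ?R)"
    using kernelD(4)[OF k(1)] kernelD(4)[OF k'(1)] by simp_all
  then have "null k" unfolding null_def by simp
  then have pk: "p1 \<odot> k = p2 \<odot> k"
    using null_centralD[OF f, of p1 ?R p2 k K] pullback_square(1)[OF R] by simp
  obtain d where d: "d \<in> Hom C ?X ?R" "p1 \<odot> d = Id C ?X" "p2 \<odot> d = Id C ?X"
    by (rule pullback_lift[OF R, of "Id C ?X" ?X "Id C ?X"]) simp_all
  note [simp] = HomD[OF d(1)]
  have "\<pi>1 \<odot> (c \<odot> k) = zer K (refl_obj b ?R)" by (simp add: precomp_eq[OF c(2)] k0)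
  then obtain a where a: "a \<in> Hom C K K'" "k' \<odot> a = c \<odot> k"
    using kernel_lift[OF k'(1), of "c \<odot> k" K] by auto
  note [simp] = HomD[OF a(1)]
  have "?\<eta>X \<odot> (\<pi>2 \<odot> k') = refl_arr b p1 \<odot> (\<pi>1 \<odot> k')"
    using precomp_eq[OF pullback_square(1)[OF Q], of k'] by simp
  then have "null (\<pi>2 \<odot> k')" unfolding null_def by (simp add: k0)
  from null_image[OF this, of d ?R] have "?\<eta>R \<odot> (d \<odot> (\<pi>2 \<odot> k')) = zer K' (refl_obj b ?R)"
    unfolding null_def by simp
  then obtain j where j: "j \<in> Hom C K' K" "k \<odot> j = d \<odot> (\<pi>2 \<odot> k')"
    using kernel_lift[OF k(1), of "d \<odot> (\<pi>2 \<odot> k')" K'] by auto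
  note [simp] = HomD[OF j(1)]
  \<comment> \<open>An element of the kernel of \<open>\<pi>1\<close> is a null element of the domain of \<open>f\<close>; the diagonal maps it back
      to a null element of \<open>R\<close>, so \<open>j\<close> is inverse to \<open>a\<close>.\<close>
  have kaj: "k' \<odot> (a \<odot> j) = c \<odot> (d \<odot> (\<pi>2 \<odot> k'))"
    by (simp add: precomp_eq[OF a(2)] j(2))
  have "k' \<odot> (a \<odot> j) = k' \<odot> Id C K'"
    by (rule pullback_eq[OF Q, of _ K'], unfold kaj)
       (simp_all add: precomp_eq[OF c(2)] precomp_eq[OF c(3)] precomp_eq[OF d(2)] k0 null_def
          \<open>?\<eta>R \<odot> (d \<odot> (\<pi>2 \<odot> k')) = zer K' (refl_obj b ?R)\<close>)
  from mono_cancel[OF kernel_mono[OF k'(1)] this, of K'] have aj: "a \<odot> j = Id C K'" by simp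
  have kja: "k \<odot> (j \<odot> a) = d \<odot> (p1 \<odot> k)"
    by (simp add: precomp_eq[OF j(2)] a(2) precomp_eq[OF c(3)])
  have "k \<odot> (j \<odot> a) = k \<odot> Id C K"
    by (rule pullback_eq[OF R, of _ K], unfold kja)
       (simp_all add: precomp_eq[OF d(2)] precomp_eq[OF d(3)] pk)
  from mono_cancel[OF kernel_mono[OF k(1)] this, of K] have ja: "j \<odot> a = Id C K" by simp
  have "is_iso C a" unfolding is_iso_def using aj ja j(1) by auto
  then have "is_iso C c"
    by (intro short_five[OF unit_regular_epi k(1) \<pi>1_epi k'(1), of a c "Id C (refl_obj b ?R)"])
       (simp_all add: a(2) c(2) is_iso_id)
  then obtain c' where c': "c' \<in> Hom C ?Q ?R" "c' \<odot> c = Id C ?R" "c \<odot> c' = Id C ?Q"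
    by (rule is_iso_inverse) simp
  note [simp] = HomD[OF c'(1)]
  have "\<exists>!h. h \<in> Hom C Z ?R \<and> ?\<eta>R \<odot> h = x \<and> p1 \<odot> h = y"
    if x: "x \<in> Hom C Z (refl_obj b ?R)" and y: "y \<in> Hom C Z ?X" and xy: "refl_arr b p1 \<odot> x = ?\<eta>X \<odot> y"
    for Z x y
  proof -
    note [simp] = HomD[OF x] HomD[OF y]
    obtain h where h: "h \<in> Hom C Z ?Q" "\<pi>1 \<odot> h = x" "\<pi>2 \<odot> h = y"
      by (rule pullback_lift[OF Q, of x Z y]) (simp_all add: xy)
    note [simp] = HomD[OF h(1)]
    have "?\<eta>R \<odot> (c' \<odot> h) = \<pi>1 \<odot> (c \<odot> (c' \<odot> h))" "p1 \<odot> (c' \<odot> h) = \<pi>2 \<odot> (c \<odot> (c' \<odot> h))"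
      by (simp_all add: precomp_eq[OF c(2)] precomp_eq[OF c(3)])
    then have 1: "?\<eta>R \<odot> (c' \<odot> h) = x" "p1 \<odot> (c' \<odot> h) = y"
      using precomp_eq[OF c'(3), of h] h by simp_all
    have 2: "l = c' \<odot> h" if l: "l \<in> Hom C Z ?R" "?\<eta>R \<odot> l = x" "p1 \<odot> l = y" for l
    proof -
      note [simp] = HomD[OF l(1)]
      have "c \<odot> l = h"
        by (rule pullback_eq[OF Q, of _ Z])
           (simp_all add: precomp_eq[OF c(2)] precomp_eq[OF c(3)] l h)
      then show ?thesis using precomp_eq[OF c'(2), of l] by simp
    qed
    show ?thesis by (rule ex1I[of _ "c' \<odot> h"]) (use 1 2 in simp_all)
  qed
  then have "\<forall>Z. \<forall>x \<in> Hom C Z (refl_obj b ?R). \<forall>y \<in> Hom C Z ?X. refl_arr b p1 \<odot> x = ?\<eta>X \<odot> y \<longrightarrow>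
      (\<exists>!h. h \<in> Hom C Z ?R \<and> ?\<eta>R \<odot> h = x \<and> p1 \<odot> h = y)"
    by blast
  then have "is_pullback C ?\<eta>R p1 (refl_arr b p1) ?\<eta>X"
    unfolding is_pullback_def using nat by simp
  then show ?thesis unfolding trivial_extension_def using p1_epi by simp
qed

lemma central_iff_null_central: "central_extension C b f \<longleftrightarrow> null_central f"
proof
  assume f: "null_central f"
  then have f_epi: "regular_epi C f" unfolding null_central_def by simp
  then obtain p1 p2 where R: "kernel_pair C p1 p2 f" using pullback_exists[of f f] by auto
  with null_central_kernel_pair_trivial[OF f R] f_epi show "central_extension C b f"
    unfolding central_extension_def by blast
qed (rule central_imp_null_central[OF reflector order_refl])

section \<open>Perfect objects and central extensions\<close>

lemma null_central_projection:
  assumes P: "is_product C p1 p2 X Y" and Y: "Y \<in> B"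
  shows "null_central p1"
  unfolding null_central_def
proof (intro conjI allI ballI impI)
  note [simp] = productD[OF P]
  have "Id C X \<in> Hom C X X" "zer X Y \<in> Hom C X Y" by simp_all
  note s = tuple_props[OF P this]
  show "regular_epi C p1" by (rule regular_epi_split[OF _ s(1,2)]) simp
  fix Z W h1 h2 x assume h1: "h1 \<in> Hom C Z (Dom C p1)" and h2: "h2 \<in> Hom C Z (Dom C p1)"
    and x: "x \<in> Hom C W Z" and *: "p1 \<odot> h1 = p1 \<odot> h2 \<and> null x"
  note [simp] = HomD[OF h1] HomD[OF h2] HomD[OF x]
  have "p1 \<odot> (h1 \<odot> x) = p1 \<odot> (h2 \<odot> x)" using precomp_eq[OF conjunct1[OF *], of x] by simp
  moreover have "(p2 \<odot> h) \<odot> x = zer W Y" if "h \<in> Hom C Z (Dom C p1)" for h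
    using null_to_subcat[of x "p2 \<odot> h" Y] * Y that by simp
  from this[OF h1] this[OF h2] have "p2 \<odot> (h1 \<odot> x) = p2 \<odot> (h2 \<odot> x)" by simp
  ultimately show "h1 \<odot> x = h2 \<odot> x"
    using product_eq[OF P, of "h1 \<odot> x" W "h2 \<odot> x"] by simp
qed

text \<open>
  The object is the kernel \<open>\<kappa>: M \<rightarrow> V\<close> of the unit of the domain \<open>V\<close> of \<open>f\<close>. It covers the codomain
  because there all elements are null, so that they lift to null elements of \<open>V\<close>. It is perfect for
  the following reason. Let \<open>E\<close> be the pullback of \<open>f\<close> and \<open>f \<odot> \<kappa>\<close>, with projections \<open>e1\<close> to \<open>V\<close> and
  \<open>e2\<close> to \<open>M\<close>. Since \<open>f\<close> is central, \<open>e1\<close> and \<open>\<kappa> \<odot> e2\<close> agree on null elements. An element of \<open>M\<close> is null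
  in \<open>V\<close>, so it lifts along \<open>e1\<close> to a null element of \<open>E\<close>, whose image under \<open>e2\<close> is the given element
  and is null in \<open>M\<close>.
\<close>

lemma perfect_core:
  assumes f: "null_central f" and U: "perfect C b (Cod C f)"
  obtains M \<kappa> where "\<kappa> \<in> Hom C M (Dom C f)" "null_central (f \<odot> \<kappa>)" "perfect C b M"
proof -
  have f_epi: "regular_epi C f" using f unfolding null_central_def by simp
  then have [simp]: "f \<in> Arr C" by simp
  let ?V = "Dom C f" let ?U = "Cod C f"
  obtain \<kappa> M where \<kappa>: "is_kernel C \<kappa> (refl_unit b ?V)" "\<kappa> \<in> Hom C M ?V"
    using kernel_exists[of "refl_unit b ?V" ?V "refl_obj b ?V"] by auto
  note [simp] = HomD[OF \<kappa>(2)]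
  note \<kappa>_mono = kernel_mono[OF \<kappa>(1)]
  have null_\<kappa>: "null \<kappa>" using kernelD(4)[OF \<kappa>(1)] unfolding null_def by simp
  have ff: "f \<in> Hom C ?V ?U" and ii: "Id C ?U \<in> Hom C ?U ?U" "null (Id C ?U)"
    using U unfolding perfect_iff_null_id by simp_all
  obtain W c x where c: "c \<in> Hom C W ?U" "regular_epi C c"
    and x: "x \<in> Hom C W ?V" "null x" "f \<odot> x = Id C ?U \<odot> c"
    by (rule null_lift[OF ff f_epi ii])
  note [simp] = HomD[OF c(1)] HomD[OF x(1)]
  have "refl_unit b ?V \<odot> x = zer W (refl_obj b ?V)" using x(2) unfolding null_def by simp
  then obtain y where y: "y \<in> Hom C W M" "\<kappa> \<odot> y = x" using kernel_lift[OF \<kappa>(1), of x W] by auto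
  note [simp] = HomD[OF y(1)]
  have f\<kappa>_epi: "regular_epi C (f \<odot> \<kappa>)"
    by (rule regular_epi_cancel_left[of _ y]) (use x(3) y(2) c(2) in simp_all)
  obtain e1 e2 where E: "is_pullback C e1 e2 f (f \<odot> \<kappa>)" using pullback_exists[of f "f \<odot> \<kappa>"] by auto
  note [simp] = pullbackD[OF E, simplified]
  have e1: "e1 \<in> Hom C (Dom C e1) ?V" "regular_epi C e1" using regular_epi_pullback[OF E f\<kappa>_epi] by simp_all
  obtain W' c' x' where c': "c' \<in> Hom C W' M" "regular_epi C c'"
    and x': "x' \<in> Hom C W' (Dom C e1)" "null x'" "e1 \<odot> x' = \<kappa> \<odot> c'"
    by (rule null_lift[OF e1 \<kappa>(2) null_\<kappa>])
  note [simp] = HomD[OF c'(1)] HomD[OF x'(1)]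
  have "e1 \<odot> x' = (\<kappa> \<odot> e2) \<odot> x'"
    by (rule null_centralD[OF f, of _ "Dom C e1" _ _ W'])
       (use pullback_square(1)[OF E] x'(2) in simp_all)
  then have "\<kappa> \<odot> (e2 \<odot> x') = \<kappa> \<odot> c'" using x'(3) by simp
  from mono_cancel[OF \<kappa>_mono this, of W'] have e2x': "e2 \<odot> x' = c'" by simp
  have "null (e2 \<odot> x')" by (rule null_image[OF x'(2)]) simp
  then have "refl_unit b M \<odot> c' = zer M (refl_obj b M) \<odot> c'" unfolding e2x' null_def by simp
  from regular_epi_cancel_right[OF c'(2) _ _ this, of "refl_obj b M"]
  have "perfect C b M" unfolding perfect_iff_null_id null_def by simp
  moreover have "null_central (f \<odot> \<kappa>)"
    by (rule null_central_comp_mono[OF f \<kappa>_mono \<kappa>(2) f\<kappa>_epi])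
  ultimately show thesis using that \<kappa>(2) by blast
qed

lemma kernel_pair_product:
  assumes f: "null_central f" and U: "perfect C b (Dom C f)" and R: "kernel_pair C p1 p2 f"
  shows "is_product C p1 (refl_unit b (Dom C p1)) (Dom C f) (refl_obj b (Dom C p1))"
proof -
  note [simp] = pullbackD[OF R]
  let ?R = "Dom C p1" let ?U = "Dom C f" let ?\<eta> = "refl_unit b ?R"
  have T: "is_pullback C ?\<eta> p1 (refl_arr b p1) (refl_unit b ?U)"
    using null_central_kernel_pair_trivial[OF f R] unfolding trivial_extension_def by simp
  have Z: "terminal_object C (refl_obj b ?U)" using U unfolding perfect_def zero_object_def by simp
  have "\<exists>!h. h \<in> Hom C Z ?R \<and> p1 \<odot> h = x \<and> ?\<eta> \<odot> h = y"
    if x: "x \<in> Hom C Z ?U" and y: "y \<in> Hom C Z (refl_obj b ?R)" for Z x y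
  proof -
    note [simp] = HomD[OF x] HomD[OF y]
    have "\<exists>!z. z \<in> Hom C Z (refl_obj b ?U)" using Z unfolding terminal_object_def by simp
    then have "refl_arr b p1 \<odot> y = refl_unit b ?U \<odot> x" by (rule Ex1_at_most_one) simp_all
    then obtain h where h: "h \<in> Hom C Z ?R" "?\<eta> \<odot> h = y" "p1 \<odot> h = x"
      using pullback_lift[OF T, of y Z x] by auto
    moreover have "l = h" if "l \<in> Hom C Z ?R" "p1 \<odot> l = x" "?\<eta> \<odot> l = y" for l
      using pullback_eq[OF T, of l Z h] that h by simp
    ultimately show ?thesis by blast
  qed
  then have "\<forall>Z. \<forall>x \<in> Hom C Z ?U. \<forall>y \<in> Hom C Z (refl_obj b ?R).
      \<exists>!h. h \<in> Hom C Z ?R \<and> p1 \<odot> h = x \<and> ?\<eta> \<odot> h = y" by blast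
  then show ?thesis unfolding is_product_def by simp
qed

text \<open>
  By the preceding lemma the kernel pair \<open>R\<close> of a central extension with perfect domain \<open>U\<close> is
  \<open>U \<times> b R\<close>. So \<open>b R\<close> is a copy of the kernel of \<open>f\<close>, embedded by \<open>j\<close> with \<open>(0, j x) \<in> R\<close>, and
  \<open>\<eta>(j x, j y)\<close> is a subtraction on it: it vanishes for \<open>x = y\<close> because the diagonal maps the
  perfect object \<open>U\<close> to \<open>b R\<close>.
\<close>

lemma kernel_pair_reflection_abelian:
  assumes f: "null_central f" and U: "perfect C b (Dom C f)" and R: "kernel_pair C p1 p2 f"
  shows "refl_obj b (Dom C p1) \<in> abelian_objects C"
proof -
  note [simp] = pullbackD[OF R]
  let ?R = "Dom C p1" let ?U = "Dom C f" let ?\<eta> = "refl_unit b ?R" let ?K = "refl_obj b ?R"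
  note P = kernel_pair_product[OF f U R]
  have "zer ?K ?U \<in> Hom C ?K ?U" "Id C ?K \<in> Hom C ?K ?K" by simp_all
  then obtain r where r: "r \<in> Hom C ?K ?R" "p1 \<odot> r = zer ?K ?U" "?\<eta> \<odot> r = Id C ?K"
    using tuple_props[OF P] by blast
  note [simp] = HomD[OF r(1)]
  define j where "j = p2 \<odot> r"
  have j: "j \<in> Hom C ?K ?U" by (simp add: j_def)
  note [simp] = HomD[OF j]
  have fj: "f \<odot> j = zer ?K (Cod C f)"
    using precomp_eq[OF pullback_square(1)[OF R], of r] by (simp add: j_def r(2))
  obtain d where d: "d \<in> Hom C ?U ?R" "p1 \<odot> d = Id C ?U" "p2 \<odot> d = Id C ?U"
    by (rule pullback_lift[OF R, of "Id C ?U" ?U "Id C ?U"]) simp_all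
  note [simp] = HomD[OF d(1)]
  have \<eta>d: "?\<eta> \<odot> d = zer ?U ?K"
    using null_to_subcat[of "Id C ?U" "?\<eta> \<odot> d" ?K] U refl_obj_mem[of ?R]
    unfolding perfect_iff_null_id by simp
  obtain q1 q2 where Q: "is_product C q1 q2 ?K ?K" using product_exists[of ?K ?K] by auto
  note [simp] = productD[OF Q]
  obtain \<rho> where \<rho>: "\<rho> \<in> Hom C (Dom C q1) ?R" "p1 \<odot> \<rho> = j \<odot> q1" "p2 \<odot> \<rho> = j \<odot> q2"
    by (rule pullback_lift[OF R, of "j \<odot> q1" "Dom C q1" "j \<odot> q2"])
       (simp_all add: precomp_eq[OF fj])
  note [simp] = HomD[OF \<rho>(1)]
  show ?thesis
  proof (rule subtraction_abelian[OF Q, of "?\<eta> \<odot> \<rho>"])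
    show "?\<eta> \<odot> \<rho> \<in> Hom C (Dom C q1) ?K" by simp
  next
    fix Z y assume y: "y \<in> Hom C Z ?K"
    note [simp] = HomD[OF y]
    have z: "zer Z ?K \<in> Hom C Z ?K" by simp
    note t = tuple_props[OF Q z y]
    note [simp] = HomD[OF t(1)]
    have "\<rho> \<odot> tuple C q1 q2 (zer Z ?K) y = r \<odot> y"
      by (rule pullback_eq[OF R, of _ Z])
         (simp_all add: precomp_eq[OF \<rho>(2)] precomp_eq[OF \<rho>(3)] precomp_eq[OF r(2)] t, simp add: j_def)
    then show "(?\<eta> \<odot> \<rho>) \<odot> tuple C q1 q2 (zer Z ?K) y = y"
      by (simp add: precomp_eq[OF r(3)])
  next
    fix Z x assume x: "x \<in> Hom C Z ?K"
    note [simp] = HomD[OF x]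
    note t = tuple_props[OF Q x x]
    note [simp] = HomD[OF t(1)]
    have "\<rho> \<odot> tuple C q1 q2 x x = d \<odot> (j \<odot> x)"
      by (rule pullback_eq[OF R, of _ Z])
         (simp_all add: precomp_eq[OF \<rho>(2)] precomp_eq[OF \<rho>(3)] precomp_eq[OF d(2)] precomp_eq[OF d(3)] t)
    then show "(?\<eta> \<odot> \<rho>) \<odot> tuple C q1 q2 x x = zer Z ?K"
      by (simp add: precomp_eq[OF \<eta>d])
  qed
qed

text \<open>
  For groups this says that a central extension with perfect domain has a central kernel, even when
  \<open>B\<close> is larger than the abelian groups. The kernel pair \<open>R\<close> is the product of the domain with the
  abelian object \<open>b R\<close>. So \<open>b R\<close> is also the reflection of \<open>R\<close> into the smaller subcategory \<open>D\<close>, and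
  triviality of the projection relative to \<open>B\<close> carries over to \<open>D\<close>.
\<close>

lemma central_perfect_domain:
  assumes a: "is_reflector C D a" and D: "abelian_objects C \<subseteq> D" "D \<subseteq> B"
    and f: "null_central f" and U: "perfect C b (Dom C f)"
  shows "central_extension C a f" "perfect C a (Dom C f)"
proof -
  interpret a: reflective_subcat C D a using a by unfold_locales
  have f_epi: "regular_epi C f" using f unfolding null_central_def by simp
  then have [simp]: "f \<in> Arr C" by simp
  let ?U = "Dom C f"
  have "refl_unit a ?U = zer ?U (refl_obj a ?U)"
    using null_to_subcat[of "Id C ?U" "refl_unit a ?U" "refl_obj a ?U"] U a.refl_obj_mem[of ?U] D
    unfolding perfect_iff_null_id by auto
  then show perfect_a: "perfect C a ?U"
    unfolding a.perfect_iff_null_id a.null_def by simp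
  obtain p1 p2 where R: "kernel_pair C p1 p2 f" using pullback_exists[of f f] by auto
  note [simp] = pullbackD[OF R]
  let ?R = "Dom C p1" let ?\<eta> = "refl_unit b ?R" let ?\<eta>a = "refl_unit a ?R"
  note P = kernel_pair_product[OF f U R]
  have p1_epi: "regular_epi C p1" by (rule regular_epi_pullback[OF R f_epi])
  have "refl_obj b ?R \<in> D" using kernel_pair_reflection_abelian[OF f U R] D by blast
  then obtain \<theta> where \<theta>: "\<theta> \<in> Hom C (refl_obj a ?R) (refl_obj b ?R)" "\<theta> \<odot> ?\<eta>a = ?\<eta>"
    using a.unit_factor[of ?\<eta> ?R] by auto
  have "refl_obj a ?R \<in> B" using a.refl_obj_mem[of ?R] D by auto
  then obtain \<phi> where \<phi>: "\<phi> \<in> Hom C (refl_obj b ?R) (refl_obj a ?R)" "\<phi> \<odot> ?\<eta> = ?\<eta>a"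
    using unit_factor[of ?\<eta>a ?R] by auto
  note [simp] = HomD[OF \<theta>(1)] HomD[OF \<phi>(1)]
  have "(\<phi> \<odot> \<theta>) \<odot> ?\<eta>a = Id C (refl_obj a ?R) \<odot> ?\<eta>a" by (simp add: \<theta>(2) \<phi>(2))
  from a.unit_eq[OF _ a.refl_obj_mem _ _ this] have \<phi>\<theta>: "\<phi> \<odot> \<theta> = Id C (refl_obj a ?R)" by simp
  have "\<exists>!h. h \<in> Hom C Z ?R \<and> ?\<eta>a \<odot> h = x \<and> p1 \<odot> h = y"
    if x: "x \<in> Hom C Z (refl_obj a ?R)" and y: "y \<in> Hom C Z ?U" for Z x y
  proof -
    note [simp] = HomD[OF x] HomD[OF y]
    have \<theta>x: "\<theta> \<odot> x \<in> Hom C Z (refl_obj b ?R)" by simp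
    note h = tuple_props[OF P y \<theta>x]
    let ?h = "tuple C p1 ?\<eta> y (\<theta> \<odot> x)"
    note [simp] = HomD[OF h(1)]
    have "?\<eta>a \<odot> ?h = \<phi> \<odot> (?\<eta> \<odot> ?h)" by (simp add: precomp_eq[OF \<phi>(2)])
    then have 1: "?\<eta>a \<odot> ?h = x" using h(3) precomp_eq[OF \<phi>\<theta>, of x] by simp
    have 2: "l = ?h" if l: "l \<in> Hom C Z ?R" "?\<eta>a \<odot> l = x" "p1 \<odot> l = y" for l
    proof (rule product_eq[OF P l(1) h(1)])
      note [simp] = HomD[OF l(1)]
      show "p1 \<odot> l = p1 \<odot> ?h" by (simp add: l(3) h(2))
      have "\<theta> \<odot> x = ?\<eta> \<odot> l" using precomp_eq[OF \<theta>(2), of l] by (simp add: l(2))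
      with h(3) show "?\<eta> \<odot> l = ?\<eta> \<odot> ?h" by metis
    qed
    show ?thesis by (rule ex1I[of _ ?h]) (use 1 2 h in simp_all)
  qed
  then have "\<forall>Z. \<forall>x \<in> Hom C Z (refl_obj a ?R). \<forall>y \<in> Hom C Z ?U.
      (\<exists>!h. h \<in> Hom C Z ?R \<and> ?\<eta>a \<odot> h = x \<and> p1 \<odot> h = y)" by blast
  then have "is_pullback C ?\<eta>a p1 (refl_arr a p1) (refl_unit a ?U)"
    unfolding is_pullback_def using a.unit_natural[of p1] by simp
  then have "trivial_extension C a p1" unfolding trivial_extension_def using p1_epi by simp
  then show "central_extension C a f" unfolding central_extension_def using f_epi R by blast
qed

section \<open>Universal central extensions\<close>

lemma Centr_Obj: "f \<in> Obj (Centr C b A) \<longleftrightarrow> f \<in> Arr C \<and> Cod C f = A \<and> central_extension C b f"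
  unfolding Centr_def full_subcat_def slice_def by simp

lemma Centr_Hom: "t \<in> Hom (Centr C b A) f g \<longleftrightarrow>
    f \<in> Obj (Centr C b A) \<and> g \<in> Obj (Centr C b A) \<and>
    (\<exists>h \<in> Hom C (Dom C f) (Dom C g). g \<odot> h = f \<and> t = (f, h, g))"
  unfolding Centr_def full_subcat_def slice_def Hom_def by auto

lemma universal_imp_weakly_universal:
  "universal_central_extension C b A u \<Longrightarrow> weakly_universal_central_extension C b A u"
  unfolding universal_central_extension_def weakly_universal_central_extension_def
    initial_object_def weakly_initial_object_def by blast

lemma weakly_universal_lift:
  assumes u: "weakly_universal_central_extension C b A u" and f: "central_extension C b f" "f \<in> Hom C X A"
  obtains h where "h \<in> Hom C (Dom C u) X" "f \<odot> h = u"
proof -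
  have "f \<in> Obj (Centr C b A)" using f unfolding Centr_Obj by simp
  then obtain t where "t \<in> Hom (Centr C b A) u f"
    using u unfolding weakly_universal_central_extension_def weakly_initial_object_def by blast
  then obtain h where "h \<in> Hom C (Dom C u) (Dom C f)" "f \<odot> h = u" unfolding Centr_Hom by blast
  with that f show thesis by simp
qed

lemma universal_lift_unique:
  assumes u: "universal_central_extension C b A u" and f: "central_extension C b f" "f \<in> Hom C X A"
    and h: "h1 \<in> Hom C (Dom C u) X" "h2 \<in> Hom C (Dom C u) X" "f \<odot> h1 = u" "f \<odot> h2 = u"
  shows "h1 = h2"
proof -
  have ob: "u \<in> Obj (Centr C b A)" "f \<in> Obj (Centr C b A)"
    using u f unfolding universal_central_extension_def initial_object_def Centr_Obj[of f] by simp_all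
  then have "\<exists>!t. t \<in> Hom (Centr C b A) u f"
    using u unfolding universal_central_extension_def initial_object_def by blast
  then have "(u, h1, f) = (u, h2, f)"
    by (rule Ex1_at_most_one) (use ob h f in \<open>simp_all add: Centr_Hom\<close>)
  then show ?thesis by simp
qed

text \<open>
  The projection of \<open>A \<times> b U\<close> onto \<open>A\<close> is central, and both \<open>(u, \<eta>)\<close> and \<open>(u, 0)\<close> are maps to it
  from \<open>u\<close>.
\<close>

lemma universal_imp_perfect:
  assumes u: "u \<in> Hom C U A" and univ: "universal_central_extension C b A u"
  shows "perfect C b U"
proof -
  note [simp] = HomD[OF u]
  let ?K = "refl_obj b U"
  obtain p1 p2 where P: "is_product C p1 p2 A ?K" using product_exists[of A ?K] by auto
  note [simp] = productD[OF P]
  have \<eta>: "refl_unit b U \<in> Hom C U ?K" and z: "zer U ?K \<in> Hom C U ?K" by simp_all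
  note t = tuple_props[OF P u \<eta>] and s = tuple_props[OF P u z]
  have "central_extension C b p1"
    unfolding central_iff_null_central by (rule null_central_projection[OF P refl_obj_mem]) simp
  then have "tuple C p1 p2 u (refl_unit b U) = tuple C p1 p2 u (zer U ?K)"
    by (rule universal_lift_unique[OF univ, of _ "Dom C p1"]) (use t(1,2) s(1,2) in simp_all)
  then have "refl_unit b U = zer U ?K" using t(3) s(3) by metis
  then show ?thesis unfolding perfect_iff_null_id null_def by simp
qed

text \<open>
  Replace \<open>f\<close> by its restriction \<open>f \<odot> \<kappa>\<close> to the perfect core. Both \<open>u\<close> and \<open>f \<odot> \<kappa>\<close> have perfect
  domains, so that they are central relative to \<open>Ab(\<A>)\<close> and condition (UCE) applies to them. The
  resulting map from \<open>u\<close> to \<open>u \<odot> f \<odot> \<kappa>\<close> over \<open>A\<close> is a section of \<open>f \<odot> \<kappa>\<close>, since the perfect object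
  \<open>U\<close> has only one endomorphism over \<open>A\<close>.
\<close>

lemma central_over_weakly_universal_splits:
  assumes ab: "is_reflector C (abelian_objects C) ab" "UCE C ab" "abelian_objects C \<subseteq> B"
    and u: "u \<in> Hom C U A" "central_extension C b u" "perfect C b U" "weakly_universal_central_extension C b A u"
    and f: "central_extension C b f" "Cod C f = U"
  shows "splits C f"
proof -
  note [simp] = HomD[OF u(1)]
  have [simp]: "f \<in> Arr C" using f(1) unfolding central_extension_def by simp
  have nu: "null_central u" and nf: "null_central f" using u f by (simp_all add: central_iff_null_central)
  have "perfect C b (Cod C f)" using f u by simp
  then obtain M \<kappa> where \<kappa>: "\<kappa> \<in> Hom C M (Dom C f)" "null_central (f \<odot> \<kappa>)" and M: "perfect C b M"
    by (rule perfect_core[OF nf])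
  note [simp] = HomD[OF \<kappa>(1)] f(2)
  have u_ab: "central_extension C ab u" "perfect C ab (Dom C u)"
    using central_perfect_domain[OF ab(1) order_refl ab(3) nu] u(3) by simp_all
  have "central_extension C ab (f \<odot> \<kappa>)"
    using central_perfect_domain(1)[OF ab(1) order_refl ab(3) \<kappa>(2)] M by simp
  with u_ab have "central_extension C ab (u \<odot> (f \<odot> \<kappa>))"
    using ab(2) unfolding UCE_def by simp
  then have "central_extension C b (u \<odot> (f \<odot> \<kappa>))"
    unfolding central_iff_null_central by (rule central_imp_null_central[OF ab(1,3)])
  then obtain h where h: "h \<in> Hom C U M" "(u \<odot> (f \<odot> \<kappa>)) \<odot> h = u"
    using weakly_universal_lift[OF u(4), of "u \<odot> (f \<odot> \<kappa>)" M] by auto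
  note [simp] = HomD[OF h(1)]
  have "f \<odot> (\<kappa> \<odot> h) = Id C U"
    by (rule perfect_maps_eq[OF nu u(3)]) (use h(2) in simp_all)
  then show ?thesis unfolding splits_def by (intro conjI bexI[of _ "\<kappa> \<odot> h"]) simp_all
qed

lemma splits_imp_projective:
  assumes [simp]: "U \<in> Obj C" and sp: "\<And>f. central_extension C b f \<Longrightarrow> Cod C f = U \<Longrightarrow> splits C f"
  shows "projective_wrt_central C b U"
  unfolding projective_wrt_central_def
proof (intro conjI allI ballI impI)
  fix f y assume f: "central_extension C b f" and y: "y \<in> Hom C U (Cod C f)"
  note [simp] = HomD[OF y]
  have [simp]: "f \<in> Arr C" using f unfolding central_extension_def by simp
  obtain p q where P: "is_pullback C p q y f" using pullback_exists[of y f] by auto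
  note [simp] = pullbackD[OF P, simplified]
  have "central_extension C b p"
    using null_central_pullback[OF _ P] f unfolding central_iff_null_central by simp
  then have "splits C p" by (rule sp) simp
  then obtain s where s: "s \<in> Hom C U (Dom C p)" "p \<odot> s = Id C U" unfolding splits_def by auto
  note [simp] = HomD[OF s(1)]
  show "\<exists>x \<in> Hom C U (Dom C f). f \<odot> x = y"
    by (rule bexI[of _ "q \<odot> s"])
       (use precomp_eq[OF pullback_square(1)[OF P], of s] s(2) in simp_all)
qed simp

lemma perfect_projective_imp_universal:
  assumes u: "u \<in> Hom C U A" "central_extension C b u" and U: "perfect C b U" "projective_wrt_central C b U"
  shows "universal_central_extension C b A u"
  unfolding universal_central_extension_def initial_object_def
proof (intro conjI ballI)
  note [simp] = HomD[OF u(1)]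
  show u_ob: "u \<in> Obj (Centr C b A)" using u unfolding Centr_Obj by simp
  fix f assume f_ob: "f \<in> Obj (Centr C b A)"
  then have f: "f \<in> Arr C" "Cod C f = A" "central_extension C b f" unfolding Centr_Obj by simp_all
  have "u \<in> Hom C U (Cod C f)" using f by simp
  then obtain h where h: "h \<in> Hom C U (Dom C f)" "f \<odot> h = u"
    using U(2) f(3) unfolding projective_wrt_central_def by blast
  show "\<exists>!t. t \<in> Hom (Centr C b A) u f"
  proof (rule ex1I)
    show "(u, h, f) \<in> Hom (Centr C b A) u f" unfolding Centr_Hom using u_ob f_ob h by simp
    fix t assume "t \<in> Hom (Centr C b A) u f"
    then obtain k where k: "k \<in> Hom C U (Dom C f)" "f \<odot> k = u" "t = (u, k, f)"
      unfolding Centr_Hom by auto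
    have "k = h"
      by (rule perfect_maps_eq[OF _ U(1) k(1) h(1)]) (use f k h in \<open>simp_all add: central_iff_null_central\<close>)
    then show "t = (u, h, f)" using k by simp
  qed
qed

end

theorem proposition4p3:
  fixes C :: "('o, 'm) cat" and B :: "'o set"
    and ab b :: "('o, 'm) reflector" and U A :: 'o and u :: 'm
  assumes "semi_abelian C"
    and "enough_projectives C"
    and "is_reflector C (abelian_objects C) ab"
    and "UCE C ab"
    and "birkhoff_subcategory C B"
    and "is_reflector C B b"
    and "abelian_objects C \<subseteq> B"
    and "u \<in> Hom C U A"
    and "central_extension C b u"
  shows "(perfect C b U \<and> weakly_universal_central_extension C b A u \<longrightarrow>
           perfect C b U \<and> (\<forall>f. central_extension C b f \<and> Cod C f = U \<longrightarrow> splits C f)) \<and>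
         (universal_central_extension C b A u \<longleftrightarrow>
           perfect C b U \<and> projective_wrt_central C b U)"
proof -
  interpret category C using assms(1) by (simp add: semi_abelian_def)
  interpret birkhoff_reflection C B b
    using assms(1,5,6) by unfold_locales (auto simp: semi_abelian_def barr_exact_def)
  have weak: "splits C f"
    if "perfect C b U" "weakly_universal_central_extension C b A u" "central_extension C b f" "Cod C f = U" for f
    using central_over_weakly_universal_splits assms(3,4,7-9) that by blast
  have "perfect C b U \<and> projective_wrt_central C b U" if univ: "universal_central_extension C b A u"
  proof -
    have U: "perfect C b U" by (rule universal_imp_perfect[OF assms(8) univ])
    moreover have "projective_wrt_central C b U"
      by (rule splits_imp_projective)
         (use weak[OF U universal_imp_weakly_universal[OF univ]] U in \<open>auto simp: perfect_def\<close>)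
    ultimately show ?thesis by simp
  qed
  with weak perfect_projective_imp_universal[OF assms(8,9)] show ?thesis by blast
qed

end
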